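(* Let $n\ge2$, let $\Omega\subset\mathbb{R}^{n}$ be a bounded Lipschitz domain and let $0<k<k_{*}$. For each $i=1,\dots,m$, let $\lambda_{i}>0$ be a constant, let $\mu_{i}\in L^{\infty}(\mathbb{R}^{n})$ with $\operatorname{supp}(\mu_{i})\subset\Omega$, put $f_{i}=\mu_{i}-\lambda_{i}$ and $k_i=k$, and let $Q_{i}=\{v_{*,i}>0\}$, where $v_{*,i}$ is the unique minimizer of $\mathcal{J}_{k_{i}}$ in $\mathbb{K}_{1}(\Omega)$. Suppose that $$\overline{Q_{i}}\cap\operatorname{supp}(\mu_{j})=\emptyset\quad\text{for all }i\ne j,$$ and let $\mathbf{k}=(k,k,\dots,k)$. If $$\inf_{x\in U_{i}}\mu_{i}(x)>\lambda_{i}\quad\text{holds for all }i=1,\dots,m,$$ for some open sets $U_{i}\subset\operatorname{supp}(\mu_{i})$, then all minimizers $\mathbf{u}_{*}=(u_{*,1},\dots,u_{*,m})$ of $\mathcal{J}_{\mathbf{k}}$ in $\mathbb{S}_{m}(\Omega)$ satisfy the support condition $$\overline{U_{i}}\subset\operatorname{supp}(u_{*,i})\quad\text{for all }i=1,\dots,m.$$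
   Context: For $\mathbf{u}=(u_{1},\dots,u_{m})\in(H^{1}(\Omega))^{m}$, $$\mathcal{J}_{\mathbf{k}}(\mathbf{u}):=\sum_{i=1}^{m}\mathcal{J}_{k_{i}}(u_{i}),\qquad \mathcal{J}_{k_{i}}(u_{i}):=\int_{\Omega}\left(|\nabla u_{i}|^{2}-k_{i}^{2}|u_{i}|^{2}-2f_{i}u_{i}\right)dx.$$ Define $$\mathbb{K}_{m}(\Omega):=\{(u_{1},\dots,u_{m})\in(H_{0}^{1}(\Omega))^{m}:u_{i}\ge0\text{ for all }i\},$$ $$\mathbb{S}_{m}(\Omega):=\{(u_{1},\dots,u_{m})\in\mathbb{K}_{m}(\Omega):u_{i}\cdot u_{j}=0\text{ for all }i\ne j\}.$$ The number $k_{*}=k_{*}(\Omega)>0$ is given by $$k_{*}^{2}:=\inf_{\phi\in C_{c}^{\infty}(\Omega),\,\phi\not\equiv0}\frac{\|\nabla\phi\|_{L^{2}(\Omega)}^{2}}{\|\phi\|_{L^{2}(\Omega)}^{2}}.$$ For $0\le k_i<k_*$ the functional $\mathcal{J}_{k_i}$ has a unique minimizer in $\mathbb{K}_{1}(\Omega)$. Convention: $\{v>0\}:=\mathbb{R}^{n}\setminus\{v\le0\}$. Since $\mu_i\in L^\infty$, the infimum is the essential infimum. *)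

theory Defs
  imports "HOL-Analysis.Analysis"
begin

text \<open>
  Elements of Lebesgue and Sobolev spaces are represented by pointwise functions on the whole
  space. A statement about an element of such a space quantifies over all of its representatives,
  in particular over the continuous one whenever it exists.
\<close>

subsection \<open>Domains\<close>

text \<open>
  Near each boundary point, the domain is the region above a Lipschitz graph in some orthogonal
  coordinate system. The system enters only through its last axis \<open>\<nu>\<close>; the graph function \<open>\<gamma>\<close> lives
  on the hyperplane orthogonal to \<open>\<nu>\<close>.
\<close>

definition Lipschitz_boundary :: "'a::euclidean_space set \<Rightarrow> bool" where
  "Lipschitz_boundary \<Omega> \<longleftrightarrow>
     (\<forall>p\<in>frontier \<Omega>. \<exists>\<nu> r L. \<exists>\<gamma> :: 'a \<Rightarrow> real.
        norm \<nu> = 1 \<and> r > 0 \<and> L-lipschitz_on {y. y \<bullet> \<nu> = 0} \<gamma> \<and>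
        \<Omega> \<inter> ball p r = {x \<in> ball p r. \<gamma> (x - (x \<bullet> \<nu>) *\<^sub>R \<nu>) < x \<bullet> \<nu>})"

definition bounded_Lipschitz_domain :: "'a::euclidean_space set \<Rightarrow> bool" where
  "bounded_Lipschitz_domain \<Omega> \<longleftrightarrow>
     open \<Omega> \<and> connected \<Omega> \<and> \<Omega> \<noteq> {} \<and> bounded \<Omega> \<and> Lipschitz_boundary \<Omega>"


subsection \<open>Test functions\<close>

primrec C_diff :: "nat \<Rightarrow> ('a::euclidean_space \<Rightarrow> real) \<Rightarrow> bool" where
  "C_diff 0 f \<longleftrightarrow> continuous_on UNIV f"
| "C_diff (Suc j) f \<longleftrightarrow> (\<forall>x. f differentiable (at x)) \<and>
     (\<forall>b\<in>Basis. C_diff j (\<lambda>x. frechet_derivative f (at x) b))"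

definition grad :: "('a::euclidean_space \<Rightarrow> real) \<Rightarrow> 'a \<Rightarrow> 'a" where
  "grad f x = (\<Sum>b\<in>Basis. frechet_derivative f (at x) b *\<^sub>R b)"

definition Cc_infinity :: "'a::euclidean_space set \<Rightarrow> ('a \<Rightarrow> real) set" where
  "Cc_infinity \<Omega> = {\<phi>. (\<forall>j. C_diff j \<phi>) \<and>
     compact (closure {x. \<phi> x \<noteq> 0}) \<and> closure {x. \<phi> x \<noteq> 0} \<subseteq> \<Omega>}"


subsection \<open>Lebesgue and Sobolev spaces\<close>

definition L2 :: "'a::euclidean_space set \<Rightarrow> ('a \<Rightarrow> 'b::euclidean_space) set" where
  "L2 \<Omega> = {f \<in> borel_measurable (lebesgue_on \<Omega>). integrable (lebesgue_on \<Omega>) (\<lambda>x. (norm (f x))\<^sup>2)}"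

definition L_infinity :: "('a::euclidean_space \<Rightarrow> real) set" where
  "L_infinity = {f \<in> borel_measurable lebesgue. \<exists>C. AE x in lebesgue. \<bar>f x\<bar> \<le> C}"

text \<open>
  The support of a class of functions modulo null sets: the complement of the largest open set on
  which the function vanishes almost everywhere.
\<close>

definition ess_supp :: "('a::euclidean_space \<Rightarrow> real) \<Rightarrow> 'a set" where
  "ess_supp f = {x. \<forall>V. open V \<and> x \<in> V \<longrightarrow> \<not> (AE y in lebesgue. y \<in> V \<longrightarrow> f y = 0)}"

definition ess_inf_on :: "'a::euclidean_space set \<Rightarrow> ('a \<Rightarrow> real) \<Rightarrow> ereal" where
  "ess_inf_on U f = Liminf (ae_filter (lebesgue_on U)) (\<lambda>x. ereal (f x))"

definition is_weak_grad ::
    "'a::euclidean_space set \<Rightarrow> ('a \<Rightarrow> real) \<Rightarrow> ('a \<Rightarrow> 'a) \<Rightarrow> bool" where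
  "is_weak_grad \<Omega> u G \<longleftrightarrow> G \<in> L2 \<Omega> \<and>
     (\<forall>\<phi>\<in>Cc_infinity \<Omega>.
        (LINT x|lebesgue_on \<Omega>. u x *\<^sub>R grad \<phi> x) = - (LINT x|lebesgue_on \<Omega>. \<phi> x *\<^sub>R G x))"

definition H1 :: "'a::euclidean_space set \<Rightarrow> ('a \<Rightarrow> real) set" where
  "H1 \<Omega> = {u \<in> L2 \<Omega>. \<exists>G. is_weak_grad \<Omega> u G}"

text \<open>Weak gradients on an open set are unique up to null sets, so the choice is immaterial.\<close>

definition weak_grad :: "'a::euclidean_space set \<Rightarrow> ('a \<Rightarrow> real) \<Rightarrow> 'a \<Rightarrow> 'a" where
  "weak_grad \<Omega> u = (SOME G. is_weak_grad \<Omega> u G)"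

definition H1_norm :: "'a::euclidean_space set \<Rightarrow> ('a \<Rightarrow> real) \<Rightarrow> real" where
  "H1_norm \<Omega> u =
     sqrt ((LINT x|lebesgue_on \<Omega>. (u x)\<^sup>2) + (LINT x|lebesgue_on \<Omega>. (norm (weak_grad \<Omega> u x))\<^sup>2))"

text \<open>
  The closure of the test functions in the Sobolev space; its elements are extended by zero to the
  whole space.
\<close>

definition H01 :: "'a::euclidean_space set \<Rightarrow> ('a \<Rightarrow> real) set" where
  "H01 \<Omega> = {u \<in> H1 \<Omega>. (\<forall>x. x \<notin> \<Omega> \<longrightarrow> u x = 0) \<and>
     (\<forall>e>0. \<exists>\<phi>\<in>Cc_infinity \<Omega>. H1_norm \<Omega> (\<lambda>x. u x - \<phi> x) < e)}"


subsection \<open>The variational problem\<close>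

definition k_star :: "'a::euclidean_space set \<Rightarrow> real" where
  "k_star \<Omega> = sqrt (INF \<phi> \<in> {\<phi> \<in> Cc_infinity \<Omega>. \<exists>x. \<phi> x \<noteq> 0}.
     (LINT x|lebesgue_on \<Omega>. (norm (grad \<phi> x))\<^sup>2) / (LINT x|lebesgue_on \<Omega>. (\<phi> x)\<^sup>2))"

definition energy ::
    "'a::euclidean_space set \<Rightarrow> ('a \<Rightarrow> real) \<Rightarrow> real \<Rightarrow> ('a \<Rightarrow> real) \<Rightarrow> real" where
  "energy \<Omega> f k u =
     (LINT x|lebesgue_on \<Omega>. (norm (weak_grad \<Omega> u x))\<^sup>2 - k\<^sup>2 * \<bar>u x\<bar>\<^sup>2 - 2 * f x * u x)"

definition total_energy ::
    "nat \<Rightarrow> 'a::euclidean_space set \<Rightarrow> (nat \<Rightarrow> 'a \<Rightarrow> real) \<Rightarrow> (nat \<Rightarrow> real) \<Rightarrow>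
     (nat \<Rightarrow> 'a \<Rightarrow> real) \<Rightarrow> real" where
  "total_energy m \<Omega> f k u = (\<Sum>i=1..m. energy \<Omega> (f i) (k i) (u i))"

text \<open>
  Tuples \<open>(u\<^sub>1, \<dots>, u\<^sub>m)\<close> are functions on \<^typ>\<open>nat\<close> of which only the values at
  \<open>1, \<dots>, m\<close> matter.
\<close>

definition K_cone :: "'a::euclidean_space set \<Rightarrow> ('a \<Rightarrow> real) set" where
  "K_cone \<Omega> = {u \<in> H01 \<Omega>. AE x in lebesgue_on \<Omega>. 0 \<le> u x}"

definition K_tuples :: "nat \<Rightarrow> 'a::euclidean_space set \<Rightarrow> (nat \<Rightarrow> 'a \<Rightarrow> real) set" where
  "K_tuples m \<Omega> = {u. \<forall>i\<in>{1..m}. u i \<in> K_cone \<Omega>}"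

definition S_tuples :: "nat \<Rightarrow> 'a::euclidean_space set \<Rightarrow> (nat \<Rightarrow> 'a \<Rightarrow> real) set" where
  "S_tuples m \<Omega> = {u \<in> K_tuples m \<Omega>.
     \<forall>i\<in>{1..m}. \<forall>j\<in>{1..m}. i \<noteq> j \<longrightarrow> (AE x in lebesgue_on \<Omega>. u i x * u j x = 0)}"

end

theory Submission
  imports Defs
begin

text \<open>
  If the conclusion fails for \<open>i\<close>, then \<open>u\<^sub>i\<close> vanishes almost everywhere on some ball in \<open>U\<^sub>i\<close>.
  Comparison gives \<open>u\<^sub>j \<le> v\<^sub>j\<close>, so the other components vanish on \<open>U\<^sub>i\<close> as well, and
  \<open>u\<^sub>i + t \<phi>\<close> is an admissible competitor for a bump function \<open>\<phi> \<ge> 0\<close> on that ball. Its energy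
  changes by \<open>- 2 t \<integral> f\<^sub>i \<phi> + O(t\<^sup>2)\<close>, which is negative for small \<open>t\<close> because \<open>f\<^sub>i > 0\<close> on \<open>U\<^sub>i\<close>.

  For the comparison, let \<open>w = u\<^sub>j - v\<^sub>j\<close> and let \<open>p\<close> be a smooth approximation of the positive part
  with \<open>0 \<le> p' \<le> 1\<close>. Testing the minimality of \<open>u\<^sub>j\<close> with \<open>u\<^sub>j - t p(w)\<close> and that of \<open>v\<^sub>j\<close> with
  \<open>v\<^sub>j + t p(w)\<close> yields \<open>k\<^sub>*\<^sup>2 \<parallel>p(w)\<parallel>\<^sup>2 \<le> \<parallel>\<nabla>p(w)\<parallel>\<^sup>2 \<le> \<integral> p'(w) |\<nabla>w|\<^sup>2 \<le> k\<^sup>2 \<integral> w p(w)\<close>, and letting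
  \<open>p\<close> tend to the positive part forces \<open>w\<^sup>+ = 0\<close> since \<open>k < k\<^sub>*\<close>.
\<close>

subsection \<open>Smooth functions and bump functions\<close>

text \<open>Both competitors in the comparison are admissible for a structural reason. Subtracting a
  truncation of (u_j - v_j)^+ from u_j does not enlarge its support, since the truncation lives
  where u_j > v_j \<ge> 0; so segregation survives. The function v_j is subject to no segregation
  constraint and may be increased freely. Both variational inequalities contain the same f_j, which
  cancels when they are added. The obstacle that shapes the file is that \<open>weak_grad\<close> is
  an arbitrary choice of a weak gradient. All calculations therefore use pairs
  \<open>H01_pair u G\<close>, that is, L2 limits of test functions together with their gradients,
  and uniqueness of weak gradients transfers the results to \<open>H1_norm\<close> and
  \<open>energy\<close>. Uniqueness rests on the fundamental lemma of the calculus of variations,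
  for which indicators of open sets are approximated by explicit test functions. The truncation is t
  exp(-e/t) for t > 0: it is smooth, its derivative lies between 0 and 1, and it stays within e of
  the positive part.\<close>

lemma C_diff_SucI:
  assumes "\<And>x. (f has_derivative F x) (at x)"
    and "\<And>b. b \<in> Basis \<Longrightarrow> C_diff j (\<lambda>x. F x b)"
  shows "C_diff (Suc j) f"
proof -
  have "frechet_derivative f (at x) = F x" for x
    using assms(1) frechet_derivative_at by metis
  then show ?thesis
    using assms by (auto simp: differentiable_def)
qed

lemma C_diff_Suc_lower: "C_diff (Suc j) f \<Longrightarrow> C_diff j f"
proof (induction j arbitrary: f)
  case 0
  then show ?case
    by (auto intro!: continuous_at_imp_continuous_on differentiable_imp_continuous_within)
next
  case (Suc j)
  then show ?case by (meson C_diff.simps(2))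
qed

lemma C_diff_SucE:
  assumes "C_diff (Suc j) f"
  shows "(f has_derivative frechet_derivative f (at x)) (at x)"
    and "b \<in> Basis \<Longrightarrow> C_diff j (\<lambda>x. frechet_derivative f (at x) b)"
  using assms frechet_derivative_works by auto

lemma C_diff_const: "C_diff j (\<lambda>x. c)"
proof (induction j arbitrary: c)
  case (Suc j)
  show ?case
    by (rule C_diff_SucI[where F = "\<lambda>x h. 0"]) (auto intro: Suc)
qed auto

lemma C_diff_add:
  assumes "C_diff j f" "C_diff j g"
  shows "C_diff j (\<lambda>x. f x + g x)"
  using assms
proof (induction j arbitrary: f g)
  case 0
  then show ?case by (auto intro: continuous_intros)
next
  case (Suc j)
  show ?case
    by (rule C_diff_SucI[OF has_derivative_add[OF C_diff_SucE(1)[OF Suc.prems(1)] C_diff_SucE(1)[OF Suc.prems(2)]]])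
       (intro Suc.IH C_diff_SucE(2)[OF Suc.prems(1)] C_diff_SucE(2)[OF Suc.prems(2)])
qed

lemma C_diff_mult:
  assumes "C_diff j f" "C_diff j g"
  shows "C_diff j (\<lambda>x. f x * g x)"
  using assms
proof (induction j arbitrary: f g)
  case 0
  then show ?case by (auto intro: continuous_intros)
next
  case (Suc j)
  show ?case
    by (rule C_diff_SucI[OF has_derivative_mult[OF C_diff_SucE(1)[OF Suc.prems(1)] C_diff_SucE(1)[OF Suc.prems(2)]]])
       (intro C_diff_add Suc.IH C_diff_SucE(2)[OF Suc.prems(1)] C_diff_SucE(2)[OF Suc.prems(2)]
          C_diff_Suc_lower[OF Suc.prems(1)] C_diff_Suc_lower[OF Suc.prems(2)])
qed

lemma C_diff_inner: "C_diff j (\<lambda>x. x \<bullet> a)"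
proof (cases j)
  case (Suc i)
  have "((\<lambda>x. x \<bullet> a) has_derivative (\<lambda>h. h \<bullet> a)) (at x)" for x
    by (auto intro!: derivative_eq_intros)
  from C_diff_SucI[OF this C_diff_const] Suc show ?thesis
    by auto
qed (auto intro: continuous_intros)

text \<open>The whole sequence of derivatives is carried along so that the induction on
  \<open>j\<close> can generalise over \<open>n\<close>: differentiating \<open>D n\<close> after
  \<open>q\<close> produces \<open>D (Suc n)\<close> after \<open>q\<close> times a derivative of
  \<open>q\<close>.\<close>

lemma C_diff_compose:
  fixes D :: "nat \<Rightarrow> real \<Rightarrow> real"
  assumes D: "\<And>n t. (D n has_real_derivative D (Suc n) t) (at t)"
    and q: "\<And>j. C_diff j q"
  shows "C_diff j (\<lambda>x. D n (q x))"
proof (induction j arbitrary: n)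
  case 0
  have "isCont (D n) t" for t
    using D DERIV_isCont by blast
  moreover have "continuous_on UNIV q"
    using q[of 0] by simp
  ultimately show ?case
    by (auto simp: continuous_at_imp_continuous_on intro: continuous_on_compose2)
next
  case (Suc j)
  have "((\<lambda>x. D n (q x)) has_derivative
      (\<lambda>h. D (Suc n) (q x) * frechet_derivative q (at x) h)) (at x)" for x
    using has_derivative_compose[OF C_diff_SucE(1)[OF q[of "Suc 0"]]
        D[unfolded has_field_derivative_def]] by simp
  then show ?case
    by (rule C_diff_SucI) (intro C_diff_mult Suc C_diff_SucE(2)[OF q])
qed

section \<open>Functions that are flat at the origin\<close>

lemma tendsto_poly_mult_exp_0: "((\<lambda>s. poly P s * exp (- s)) \<longlongrightarrow> 0) (at_top :: real filter)"
proof -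
  have "((\<lambda>s. \<Sum>i\<le>degree P. coeff P i * (s ^ i / exp s)) \<longlongrightarrow> (\<Sum>i\<le>degree P. coeff P i * 0)) (at_top :: real filter)"
    by (intro tendsto_sum tendsto_mult tendsto_const tendsto_power_div_exp_0)
  moreover have "(\<Sum>i\<le>degree P. coeff P i * (s ^ i / exp s)) = poly P s * exp (- s)" for s
    unfolding poly_altdef sum_distrib_right by (intro sum.cong) (simp_all add: exp_minus divide_inverse)
  ultimately show ?thesis by simp
qed

text \<open>The classical function exp(-1/t), extended by zero, with a polynomial in 1/t in front.
  The prefactor makes the family closed under differentiation, so smoothness needs no explicit
  higher derivatives; \<open>flat 1\<close> is the classical function itself.\<close>

definition flat :: "real poly \<Rightarrow> real \<Rightarrow> real" where
  "flat P t = (if t > 0 then poly P (1 / t) * exp (- (1 / t)) else 0)"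

lemma tendsto_flat_0: "(flat P \<longlongrightarrow> 0) (at 0)"
proof -
  have "((\<lambda>t. poly P (inverse t) * exp (- inverse t)) \<longlongrightarrow> 0) (at_right 0)"
    by (rule filterlim_compose[OF tendsto_poly_mult_exp_0 filterlim_inverse_at_top_right])
  moreover have "\<forall>\<^sub>F t in at_right 0. poly P (inverse t) * exp (- inverse t) = flat P t"
    by (auto simp: eventually_at_filter flat_def inverse_eq_divide)
  ultimately have right: "(flat P \<longlongrightarrow> 0) (at_right 0)"
    by (rule Lim_transform_eventually)
  have "\<forall>\<^sub>F t in at_left 0. 0 = flat P t"
    by (auto simp: eventually_at_filter flat_def)
  then have "(flat P \<longlongrightarrow> 0) (at_left 0)"
    by (rule Lim_transform_eventually[OF tendsto_const])
  with right show ?thesis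
    by (simp add: filterlim_at_split)
qed

text \<open>With s = 1/t one has ds/dt = -s^2, so the derivative of P(s) exp(-s) with respect to t
  is s^2 (P(s) - P'(s)) exp(-s).\<close>

definition flat_pderiv :: "real poly \<Rightarrow> real poly" where
  "flat_pderiv P = [:0, 0, 1:] * (P - pderiv P)"

lemma DERIV_flat: "(flat P has_real_derivative flat (flat_pderiv P) t) (at t)"
proof -
  consider "t > 0" | "t = 0" | "t < 0" by linarith
  then show ?thesis
  proof cases
    case 1
    have "((\<lambda>t. poly P (1 / t) * exp (- (1 / t))) has_real_derivative
        flat (flat_pderiv P) t) (at t)"
      using 1
      by (auto intro!: derivative_eq_intros simp: flat_def flat_pderiv_def)
         (simp add: field_simps power2_eq_square)
    then show ?thesis
      by (rule has_field_derivative_transform_within_open[where S = "{0<..}"])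
         (use 1 in \<open>auto simp: flat_def\<close>)
  next
    case 2
    \<comment> \<open>The division by \<open>h\<close> is absorbed as one more factor 1/h in the
      polynomial, so the difference quotient is again a flat function and tends to 0.\<close>
    have "(flat P h - flat P 0) / h = flat ([:0, 1:] * P) h" for h
      by (simp add: flat_def)
    then show ?thesis
      using tendsto_flat_0[of "[:0, 1:] * P"] 2
      by (simp add: DERIV_def flat_def[of _ 0])
  next
    case 3
    have "((\<lambda>_. 0) has_real_derivative flat (flat_pderiv P) t) (at t)"
      using 3 by (simp add: flat_def)
    then show ?thesis
      by (rule has_field_derivative_transform_within_open[where S = "{..<0}"])
         (use 3 in \<open>auto simp: flat_def\<close>)
  qed
qed

lemma C_diff_flat: "(\<And>j. C_diff j q) \<Longrightarrow> C_diff j (\<lambda>x. flat P (q x))"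
  using C_diff_compose[of "\<lambda>n. flat ((flat_pderiv ^^ n) P)" q j 0] by (simp add: DERIV_flat)

lemma flat_1_nonneg: "0 \<le> flat 1 t"
  and flat_1_le_1: "flat 1 t \<le> 1"
  and flat_1_pos_iff: "0 < flat 1 t \<longleftrightarrow> 0 < t"
  and flat_1_ge: "1 - 1 / t \<le> flat 1 t \<or> t \<le> 0"
  and flat_1_eq_0: "t \<le> 0 \<Longrightarrow> flat 1 t = 0"
  using exp_ge_add_one_self[of "- (1 / t)"] by (auto simp: flat_def)

section \<open>Bump functions and a smooth truncation of the positive part\<close>

definition bump :: "'a::euclidean_space \<Rightarrow> real \<Rightarrow> 'a \<Rightarrow> real" where
  "bump a r x = flat 1 (r\<^sup>2 - (x - a) \<bullet> (x - a))"

lemma C_diff_bump: "C_diff j (bump a r)"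
proof -
  have "((\<lambda>x. r\<^sup>2 - (x - a) \<bullet> (x - a)) has_derivative (\<lambda>h. (- 2) * (h \<bullet> (x - a)))) (at x)" for x
    by (auto intro!: derivative_eq_intros simp: inner_commute)
  moreover have "C_diff j (\<lambda>x. (- 2) * (b \<bullet> (x - a)))" for j b
    using C_diff_mult[OF C_diff_const C_diff_add[OF C_diff_inner C_diff_const],
        of j "- 2" b "- (a \<bullet> b)"]
    by (simp add: inner_diff_left inner_commute[of b])
  ultimately have "C_diff (Suc j) (\<lambda>x. r\<^sup>2 - (x - a) \<bullet> (x - a))" for j
    by (rule C_diff_SucI)
  then have "C_diff j (\<lambda>x. r\<^sup>2 - (x - a) \<bullet> (x - a))" for j
    by (rule C_diff_Suc_lower)
  then show ?thesis
    unfolding bump_def by (rule C_diff_flat)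
qed

lemma bump_nonneg: "0 \<le> bump a r x"
  and bump_le_1: "bump a r x \<le> 1"
  unfolding bump_def by (rule flat_1_nonneg flat_1_le_1)+

lemma bump_pos_iff:
  assumes "r > 0"
  shows "0 < bump a r x \<longleftrightarrow> x \<in> ball a r"
proof -
  have "(x - a) \<bullet> (x - a) < r\<^sup>2 \<longleftrightarrow> norm (x - a) < r"
    using assms power2_less_imp_less[of "norm (x - a)" r] power_strict_mono[of "norm (x - a)" r 2]
    by (auto simp: power2_norm_eq_inner)
  then show ?thesis
    by (simp add: bump_def flat_1_pos_iff dist_norm norm_minus_commute)
qed

text \<open>For \<open>e > 0\<close> this is t exp(-e/t) when t > 0 and 0 otherwise. It increases to
  the positive part as e tends to 0.\<close>

definition smooth_pos :: "real \<Rightarrow> real \<Rightarrow> real" where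
  "smooth_pos e t = t * flat 1 (t / e)"

definition smooth_pos' :: "real \<Rightarrow> real \<Rightarrow> real" where
  "smooth_pos' e t = flat 1 (t / e) + t * flat (flat_pderiv 1) (t / e) / e"

lemma DERIV_smooth_pos: "(smooth_pos e has_real_derivative smooth_pos' e t) (at t)"
proof -
  have "((\<lambda>t. flat 1 (t / e)) has_real_derivative flat (flat_pderiv 1) (t / e) * (1 / e)) (at t)"
    using DERIV_chain2[OF DERIV_flat, of "\<lambda>t. t / e" "1 / e" t UNIV 1] DERIV_cdivide[OF DERIV_ident]
    by blast
  from DERIV_mult[OF DERIV_ident this] show ?thesis
    by (simp add: smooth_pos_def[abs_def] smooth_pos'_def mult_ac)
qed

lemma continuous_smooth_pos': "continuous_on UNIV (smooth_pos' e)"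
proof -
  have "continuous_on UNIV (flat P)" for P
    using DERIV_flat DERIV_isCont by (blast intro: continuous_at_imp_continuous_on)
  then have "continuous_on UNIV (\<lambda>t. flat P (t / e))" for P
    by (rule continuous_on_compose2) (auto simp: divide_inverse intro!: continuous_intros)
  then show ?thesis
    unfolding smooth_pos'_def divide_inverse by (intro continuous_intros)
qed

lemma C_diff_smooth_pos:
  assumes "\<And>j. C_diff j q"
  shows "C_diff j (\<lambda>x. smooth_pos e (q x))"
proof -
  have "C_diff j (\<lambda>x. q x * (1 / e))" for j
    by (intro C_diff_mult assms C_diff_const)
  then show ?thesis
    unfolding smooth_pos_def by (intro C_diff_mult assms C_diff_flat) simp
qed

lemma smooth_pos_0: "t \<le> 0 \<Longrightarrow> e > 0 \<Longrightarrow> smooth_pos e t = 0"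
  by (simp add: smooth_pos_def flat_1_eq_0 divide_nonpos_pos)

lemma smooth_pos_nonneg: "e > 0 \<Longrightarrow> 0 \<le> smooth_pos e t"
  using smooth_pos_0[of t e] flat_1_nonneg[of "t / e"]
  by (cases "t \<le> 0") (auto simp: smooth_pos_def)

lemma smooth_pos_le: "e > 0 \<Longrightarrow> smooth_pos e t \<le> max 0 t"
  using smooth_pos_0[of t e] flat_1_le_1[of "t / e"]
  by (cases "t \<le> 0") (auto simp: smooth_pos_def mult_left_le)

text \<open>From exp(-e/t) \<ge> 1 - e/t. Together with \<open>smooth_pos_le\<close> it makes the
  convergence to the positive part uniform in \<open>t\<close>, with error at most
  \<open>e\<close>.\<close>

lemma smooth_pos_ge:
  assumes "e > 0"
  shows "max 0 t - e \<le> smooth_pos e t"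
proof (cases "t \<le> 0")
  case False
  then have "t * (1 - e / t) \<le> t * flat 1 (t / e)"
    using flat_1_ge[of "t / e"] assms by (intro mult_left_mono) (auto simp: divide_le_0_iff)
  with False show ?thesis
    by (simp add: smooth_pos_def algebra_simps)
qed (use assms smooth_pos_0 in auto)

text \<open>For t > 0 the derivative simplifies to (1 + e/t) exp(-e/t), and 1 + x \<le> exp x caps
  it at 1. The cap makes truncation a contraction and yields s^2 \<le> s for s =
  \<open>smooth_pos' e t\<close>, which the comparison argument needs.\<close>

lemma smooth_pos'_bounds:
  assumes "e > 0"
  shows "0 \<le> smooth_pos' e t" "smooth_pos' e t \<le> 1"
proof -
  have "smooth_pos' e t = (1 + e / t) * exp (- (e / t))" if "t > 0"
    using that assms by (simp add: smooth_pos'_def flat_def flat_pderiv_def field_simps)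
  moreover have "(1 + e / t) * exp (- (e / t)) \<le> 1"
    using exp_ge_add_one_self[of "e / t"] by (simp add: exp_minus divide_simps)
  moreover have "smooth_pos' e t = 0" if "t \<le> 0"
    using that assms by (simp add: smooth_pos'_def flat_def zero_less_divide_iff)
  ultimately show "0 \<le> smooth_pos' e t" "smooth_pos' e t \<le> 1"
    using assms by (cases "t \<le> 0", auto)+
qed

subsection \<open>Test functions\<close>

lemma has_derivative_grad:
  assumes "f differentiable (at x)"
  shows "(f has_derivative (\<lambda>h. grad f x \<bullet> h)) (at x)"
proof -
  have D: "(f has_derivative frechet_derivative f (at x)) (at x)"
    using assms frechet_derivative_works by blast
  interpret linear "frechet_derivative f (at x)"
    using D by (rule has_derivative_linear)
  have "frechet_derivative f (at x) h = grad f x \<bullet> h" for h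
  proof -
    have "frechet_derivative f (at x) h = frechet_derivative f (at x) (\<Sum>b\<in>Basis. (h \<bullet> b) *\<^sub>R b)"
      by (simp add: euclidean_representation)
    also have "\<dots> = grad f x \<bullet> h"
      by (simp add: sum scaleR grad_def inner_sum_left mult.commute inner_commute[of h])
    finally show ?thesis .
  qed
  then show ?thesis using D by presburger
qed

lemma grad_eqI:
  assumes "(f has_derivative (\<lambda>h. g \<bullet> h)) (at x)"
  shows "grad f x = g"
proof -
  have "frechet_derivative f (at x) = (\<lambda>h. g \<bullet> h)"
    using frechet_derivative_at[OF assms] by simp
  then show ?thesis
    by (simp add: grad_def euclidean_representation)
qed

lemma frechet_derivative_eq_grad:
  "f differentiable (at x) \<Longrightarrow> frechet_derivative f (at x) h = grad f x \<bullet> h"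
  using frechet_derivative_at[OF has_derivative_grad] by metis

lemma Cc_infinityI:
  assumes "\<And>j. C_diff j f" "compact K" "K \<subseteq> \<Omega>" "\<And>x. x \<notin> K \<Longrightarrow> f x = 0"
  shows "f \<in> Cc_infinity \<Omega>"
proof -
  have "closure {x. f x \<noteq> 0} \<subseteq> K"
    using assms by (intro closure_minimal) (auto simp: compact_imp_closed)
  then show ?thesis
    using assms compact_Int_closed[of K "closure {x. f x \<noteq> 0}"]
    by (auto simp: Cc_infinity_def Int_absorb1)
qed

lemma Cc_infinityE:
  assumes "f \<in> Cc_infinity \<Omega>"
  obtains K where "compact K" "K \<subseteq> \<Omega>" "\<And>x. x \<notin> K \<Longrightarrow> f x = 0" "\<And>x. x \<notin> K \<Longrightarrow> grad f x = 0"
proof -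
  define K where "K = closure {x. f x \<noteq> 0}"
  have K: "compact K" "K \<subseteq> \<Omega>"
    using assms by (auto simp: Cc_infinity_def K_def)
  have zero: "f x = 0" if "x \<in> - K" for x
    using that closure_subset[of "{x. f x \<noteq> 0}"] by (auto simp: K_def)
  have "grad f x = 0" if "x \<in> - K" for x
  proof (rule grad_eqI)
    have "((\<lambda>_. 0) has_derivative (\<lambda>h. 0 \<bullet> h)) (at x)" by simp
    moreover have "open (- K)"
      using K compact_imp_closed by blast
    ultimately show "(f has_derivative (\<lambda>h. 0 \<bullet> h)) (at x)"
      by (rule has_derivative_transform_within_open) (use that zero in simp_all)
  qed
  with K zero show thesis
    by (intro that) simp_all
qed

lemma Cc_infinity_C_diff: "f \<in> Cc_infinity \<Omega> \<Longrightarrow> C_diff j f"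
  by (simp add: Cc_infinity_def)

lemma Cc_infinity_differentiable: "f \<in> Cc_infinity \<Omega> \<Longrightarrow> f differentiable (at x)"
  using Cc_infinity_C_diff[of f \<Omega> "Suc 0"] by simp

lemmas Cc_infinity_has_derivative = has_derivative_grad[OF Cc_infinity_differentiable]

lemma Cc_infinity_mono: "\<Omega> \<subseteq> \<Omega>' \<Longrightarrow> f \<in> Cc_infinity \<Omega> \<Longrightarrow> f \<in> Cc_infinity \<Omega>'"
  by (auto simp: Cc_infinity_def)

lemma Cc_infinity_add:
  assumes "f \<in> Cc_infinity \<Omega>" "g \<in> Cc_infinity \<Omega>"
  shows "(\<lambda>x. f x + g x) \<in> Cc_infinity \<Omega>"
proof -
  obtain K where K: "compact K" "K \<subseteq> \<Omega>" "\<And>x. x \<notin> K \<Longrightarrow> f x = 0"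
    using Cc_infinityE[OF assms(1)] by metis
  obtain L where L: "compact L" "L \<subseteq> \<Omega>" "\<And>x. x \<notin> L \<Longrightarrow> g x = 0"
    using Cc_infinityE[OF assms(2)] by metis
  show ?thesis
    by (rule Cc_infinityI[of _ "K \<union> L"])
       (simp_all add: K L C_diff_add Cc_infinity_C_diff[OF assms(1)] Cc_infinity_C_diff[OF assms(2)] compact_Un)
qed

lemma Cc_infinity_mult:
  assumes "\<And>j. C_diff j g" "f \<in> Cc_infinity \<Omega>"
  shows "(\<lambda>x. g x * f x) \<in> Cc_infinity \<Omega>"
  by (rule Cc_infinityE[OF assms(2)], rule Cc_infinityI)
     (auto intro!: C_diff_mult Cc_infinity_C_diff[OF assms(2)] assms(1))

lemma Cc_infinity_cmult: "f \<in> Cc_infinity \<Omega> \<Longrightarrow> (\<lambda>x. c * f x) \<in> Cc_infinity \<Omega>"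
  by (rule Cc_infinity_mult[OF C_diff_const])

lemma Cc_infinity_zero: "(\<lambda>x. 0) \<in> Cc_infinity \<Omega>"
  by (rule Cc_infinityI[of _ "{}"]) (auto intro: C_diff_const)

text \<open>Partial derivatives may thus serve as test functions themselves; this allows a second
  derivative to be moved onto a test function later on.\<close>

lemma Cc_infinity_partial:
  assumes "f \<in> Cc_infinity \<Omega>" "b \<in> Basis"
  shows "(\<lambda>x. grad f x \<bullet> b) \<in> Cc_infinity \<Omega>"
proof (rule Cc_infinityE[OF assms(1)], rule Cc_infinityI)
  show "C_diff j (\<lambda>x. grad f x \<bullet> b)" for j
    using C_diff_SucE(2)[OF Cc_infinity_C_diff[OF assms(1)] assms(2), of j]
    by (simp add: frechet_derivative_eq_grad Cc_infinity_differentiable[OF assms(1)])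
qed auto

lemma Cc_infinity_continuous: "f \<in> Cc_infinity \<Omega> \<Longrightarrow> continuous_on UNIV f"
  using Cc_infinity_C_diff[of f \<Omega> 0] by simp

lemma Cc_infinity_continuous_grad:
  assumes "f \<in> Cc_infinity \<Omega>"
  shows "continuous_on UNIV (grad f)"
  by (subst continuous_on_componentwise) (use assms Cc_infinity_partial Cc_infinity_continuous in blast)

lemma Cc_infinity_bump: "r > 0 \<Longrightarrow> cball a r \<subseteq> \<Omega> \<Longrightarrow> bump a r \<in> Cc_infinity \<Omega>"
  using bump_pos_iff[of r a] bump_nonneg[of a r]
  by (intro Cc_infinityI[of _ "cball a r"] C_diff_bump) (auto simp: order_less_le)

lemma Cc_infinity_smooth_pos:
  assumes "f \<in> Cc_infinity \<Omega>" "e > 0"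
  shows "(\<lambda>x. smooth_pos e (f x)) \<in> Cc_infinity \<Omega>"
  by (rule Cc_infinityE[OF assms(1)], rule Cc_infinityI)
     (auto intro!: C_diff_smooth_pos Cc_infinity_C_diff[OF assms(1)] simp: smooth_pos_0 assms(2))

lemma grad_add:
  "f \<in> Cc_infinity \<Omega> \<Longrightarrow> g \<in> Cc_infinity \<Omega> \<Longrightarrow> grad (\<lambda>x. f x + g x) x = grad f x + grad g x"
  using has_derivative_add[OF Cc_infinity_has_derivative Cc_infinity_has_derivative]
  by (intro grad_eqI) (simp add: inner_add_left)

lemma grad_cmult: "f \<in> Cc_infinity \<Omega> \<Longrightarrow> grad (\<lambda>x. c * f x) x = c *\<^sub>R grad f x"
  using has_derivative_mult_right[OF Cc_infinity_has_derivative] by (intro grad_eqI) simp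

lemma grad_smooth_pos:
  assumes "f \<in> Cc_infinity \<Omega>"
  shows "grad (\<lambda>x. smooth_pos e (f x)) x = smooth_pos' e (f x) *\<^sub>R grad f x"
  using has_derivative_compose[OF Cc_infinity_has_derivative[OF assms]
      DERIV_smooth_pos[unfolded has_field_derivative_def]]
  by (intro grad_eqI) simp

lemma compact_support_bounded:
  fixes f :: "'a::euclidean_space \<Rightarrow> 'b::real_normed_vector"
  assumes "continuous_on UNIV f" "compact K" "\<And>x. x \<notin> K \<Longrightarrow> f x = 0"
  obtains C where "C \<ge> 0" "\<And>x. norm (f x) \<le> C"
proof -
  have "compact (f ` K)"
    using assms by (meson compact_continuous_image continuous_on_subset subset_UNIV)
  then obtain C where C: "\<And>y. y \<in> f ` K \<Longrightarrow> norm y \<le> C"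
    using compact_imp_bounded bounded_iff by metis
  have "norm (f x) \<le> max C 0" for x
    using C[of "f x"] assms(3)[of x] by (cases "x \<in> K") auto
  then show thesis using that[of "max C 0"] by simp
qed

lemma Cc_infinity_bounded:
  assumes "f \<in> Cc_infinity \<Omega>"
  obtains C where "C \<ge> 0" "\<And>x. \<bar>f x\<bar> \<le> C" "\<And>x. norm (grad f x) \<le> C"
proof -
  obtain K where K: "compact K" "\<And>x. x \<notin> K \<Longrightarrow> f x = 0" "\<And>x. x \<notin> K \<Longrightarrow> grad f x = 0"
    using Cc_infinityE[OF assms] by metis
  obtain C where C: "\<And>x. norm (f x) \<le> C"
    using compact_support_bounded[OF Cc_infinity_continuous[OF assms] K(1,2)] by metis
  obtain C' where C': "C' \<ge> 0" "\<And>x. norm (grad f x) \<le> C'"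
    using compact_support_bounded[OF Cc_infinity_continuous_grad[OF assms] K(1,3)] by metis
  show thesis
    using C C' by (intro that[of "max C C'"]) (auto intro: le_max_iff_disj[THEN iffD2])
qed

text \<open>Difference quotients of \<open>F\<close> in direction \<open>b\<close> have integral
  zero by translation invariance. The mean value theorem bounds them uniformly and they share a
  bounded support, so dominated convergence passes to the directional derivative. No iterated
  integrals are involved.\<close>

lemma integral_compact_support_derivative:
  fixes F :: "'a::euclidean_space \<Rightarrow> real"
  assumes F: "\<And>x. (F has_derivative (\<lambda>h. g x \<bullet> h)) (at x)"
    and cont: "continuous_on UNIV (\<lambda>x. g x \<bullet> b)"
    and K: "compact K" "\<And>x. x \<notin> K \<Longrightarrow> F x = 0" "\<And>x. x \<notin> K \<Longrightarrow> g x = 0"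
  shows "(LINT x|lborel. g x \<bullet> b) = 0"
proof -
  have cF: "continuous_on UNIV F"
    by (rule continuous_at_imp_continuous_on) (blast intro: has_derivative_continuous F)
  have mF[measurable]: "F \<in> borel_measurable borel"
    using cF by (rule borel_measurable_continuous_onI)
  have mg[measurable]: "(\<lambda>x. g x \<bullet> b) \<in> borel_measurable borel"
    using cont by (rule borel_measurable_continuous_onI)
  obtain C where C: "C \<ge> 0" "\<And>x. \<bar>g x \<bullet> b\<bar> \<le> C"
    using compact_support_bounded[OF cont K(1)] K(3) by auto
  obtain R where R: "\<And>x. x \<in> K \<Longrightarrow> norm x \<le> R"
    using K(1) compact_imp_bounded bounded_iff by metis
  \<comment> \<open>Increments are at most 1, so a point of norm above \<open>R + norm b\<close>
    lies outside \<open>K\<close> both before and after the shift; this gives the common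
    support.\<close>
  define h where "h n = 1 / real (Suc n)" for n
  have h: "h n > 0" "h n \<le> 1" for n
    by (auto simp: h_def)
  have h0: "h \<longlonglongrightarrow> 0"
    unfolding h_def using LIMSEQ_inverse_real_of_nat by (simp add: inverse_eq_divide)
  define q where "q n x = (F (x + h n *\<^sub>R b) - F x) / h n" for n x
  have line: "((\<lambda>t. F (x + t *\<^sub>R b)) has_real_derivative g (x + t *\<^sub>R b) \<bullet> b) (at t)" for x t
  proof -
    have "((\<lambda>t. x + t *\<^sub>R b) has_derivative (\<lambda>t. t *\<^sub>R b)) (at t)"
      by (auto intro!: derivative_eq_intros)
    from has_derivative_compose[OF this F]
    have "((\<lambda>t. F (x + t *\<^sub>R b)) has_derivative (\<lambda>s. g (x + t *\<^sub>R b) \<bullet> s *\<^sub>R b)) (at t)" .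
    then show ?thesis
      by (simp add: has_field_derivative_def mult_commute_abs)
  qed
  have intF: "integrable lborel F"
  proof -
    have "(\<lambda>x. indicator K x *\<^sub>R F x) = F"
      using K(2) by (auto simp: indicator_def fun_eq_iff)
    then show ?thesis
      using borel_integrable_compact[OF K(1) continuous_on_subset[OF cF subset_UNIV]] by simp
  qed
  have intF': "integrable lborel (\<lambda>x. F (x + c))" "(LINT x|lborel. F (x + c)) = (LINT x|lborel. F x)" for c
    using lborel_distr_plus[of c]
      integrable_distr_eq[of "(+) c" lborel borel F] integral_distr[of "(+) c" lborel borel F] intF
    by (simp_all add: add.commute)
  have zero: "(LINT x|lborel. q n x) = 0" for n
    unfolding q_def using intF intF' by simp
  have qC: "\<bar>q n x\<bar> \<le> C" for n x
  proof -
    have "\<exists>z>0. z < h n \<and>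
        F (x + h n *\<^sub>R b) - F (x + 0 *\<^sub>R b) = (h n - 0) * (g (x + z *\<^sub>R b) \<bullet> b)"
      by (rule MVT2[OF h(1) line])
    then obtain z where "F (x + h n *\<^sub>R b) - F (x + 0 *\<^sub>R b) = (h n - 0) * (g (x + z *\<^sub>R b) \<bullet> b)"
      by (elim exE conjE)
    then have "q n x = g (x + z *\<^sub>R b) \<bullet> b"
      using h(1)[of n] by (simp add: q_def)
    then show ?thesis using C by simp
  qed
  have q0: "q n x = 0" if "x \<notin> cball 0 (R + norm b)" for n x
  proof -
    have "norm x \<le> norm (x + h n *\<^sub>R b) + norm b"
      using norm_triangle_ineq4[of "x + h n *\<^sub>R b" "h n *\<^sub>R b"] h[of n]
        mult_right_mono[of "h n" 1 "norm b"] by simp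
    moreover have "norm x > R + norm b"
      using that by simp
    ultimately have "x \<notin> K" "x + h n *\<^sub>R b \<notin> K"
      using R[of x] R[of "x + h n *\<^sub>R b"] norm_ge_zero[of b] by linarith+
    then show ?thesis by (simp add: q_def K)
  qed
  have "(\<lambda>n. LINT x|lborel. q n x) \<longlonglongrightarrow> (LINT x|lborel. g x \<bullet> b)"
  proof (rule integral_dominated_convergence)
    show "integrable lborel (\<lambda>x. C * indicator (cball 0 (R + norm b)) x)"
      using borel_integrable_compact[of "cball 0 (R + norm b)" "\<lambda>_. C"]
      by (simp add: mult.commute)
    show "AE x in lborel. (\<lambda>n. q n x) \<longlonglongrightarrow> g x \<bullet> b"
    proof (rule AE_I2)
      fix x
      have "((\<lambda>t. (F (x + t *\<^sub>R b) - F x) / t) \<longlongrightarrow> g x \<bullet> b) (at 0)"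
        using line[of x 0] by (simp add: DERIV_def)
      moreover have "filterlim h (at 0) sequentially"
        using h0 h(1) by (simp add: filterlim_at less_imp_neq[symmetric])
      ultimately show "(\<lambda>n. q n x) \<longlonglongrightarrow> g x \<bullet> b"
        unfolding q_def by (rule filterlim_compose)
    qed
    show "AE x in lborel. norm (q n x) \<le> C * indicator (cball 0 (R + norm b)) x" for n
      using qC q0 by (auto simp: indicator_def)
  qed (auto simp: q_def)
  then have "(\<lambda>n. 0) \<longlonglongrightarrow> (LINT x|lborel. g x \<bullet> b)"
    by (simp add: zero)
  then show ?thesis
    using LIMSEQ_unique[OF _ tendsto_const] by metis
qed

subsection \<open>Square-integrable functions\<close>

lemma L2_measurable: "f \<in> L2 \<Omega> \<Longrightarrow> f \<in> borel_measurable (lebesgue_on \<Omega>)"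
  and L2_integrable: "f \<in> L2 \<Omega> \<Longrightarrow> integrable (lebesgue_on \<Omega>) (\<lambda>x. (norm (f x))\<^sup>2)"
  by (simp_all add: L2_def)

lemma L2I_bound:
  assumes "f \<in> borel_measurable (lebesgue_on \<Omega>)" "integrable (lebesgue_on \<Omega>) h"
    and "\<And>x. (norm (f x))\<^sup>2 \<le> h x"
  shows "f \<in> L2 \<Omega>"
proof -
  have "integrable (lebesgue_on \<Omega>) (\<lambda>x. (norm (f x))\<^sup>2)"
  proof (rule Bochner_Integration.integrable_bound[OF assms(2)])
    show "AE x in lebesgue_on \<Omega>. norm ((norm (f x))\<^sup>2) \<le> norm (h x)"
      using assms(3) by (intro AE_I2) (smt (verit) real_norm_def zero_le_power2)
  qed (use assms(1) in measurable)
  then show ?thesis using assms(1) by (simp add: L2_def)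
qed

lemma norm_add_sq_le: "(norm (x + y))\<^sup>2 \<le> 2 * (norm x)\<^sup>2 + 2 * (norm y)\<^sup>2"
proof -
  have "(norm (x + y))\<^sup>2 \<le> (norm x + norm y)\<^sup>2"
    by (intro power_mono norm_triangle_ineq) auto
  also have "\<dots> \<le> 2 * (norm x)\<^sup>2 + 2 * (norm y)\<^sup>2"
    using sum_squares_bound[of "norm x" "norm y"] by (simp add: power2_sum)
  finally show ?thesis .
qed

lemma L2_add: "f \<in> L2 \<Omega> \<Longrightarrow> g \<in> L2 \<Omega> \<Longrightarrow> (\<lambda>x. f x + g x) \<in> L2 \<Omega>"
  by (rule L2I_bound[OF _ _ norm_add_sq_le])
     (auto simp: L2_integrable intro: borel_measurable_add L2_measurable)

lemma L2_scaleR: "f \<in> L2 \<Omega> \<Longrightarrow> (\<lambda>x. c *\<^sub>R f x) \<in> L2 \<Omega>"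
  by (rule L2I_bound[where h = "\<lambda>x. c\<^sup>2 * (norm (f x))\<^sup>2"])
     (auto simp: L2_integrable power_mult_distrib intro: borel_measurable_scaleR L2_measurable)

lemma L2_cmult: "f \<in> L2 \<Omega> \<Longrightarrow> (\<lambda>x. c * f x :: real) \<in> L2 \<Omega>"
  using L2_scaleR[of f \<Omega> c] by simp

lemma L2_diff: "f \<in> L2 \<Omega> \<Longrightarrow> g \<in> L2 \<Omega> \<Longrightarrow> (\<lambda>x. f x - g x) \<in> L2 \<Omega>"
  using L2_add[OF _ L2_scaleR[of g \<Omega> "-1"], of f] by simp

lemma L2_bounded_mult:
  fixes s :: "'a::euclidean_space \<Rightarrow> real"
  assumes "s \<in> borel_measurable (lebesgue_on \<Omega>)" "\<And>x. \<bar>s x\<bar> \<le> C" "f \<in> L2 \<Omega>"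
  shows "(\<lambda>x. s x *\<^sub>R f x) \<in> L2 \<Omega>"
proof (rule L2I_bound[where h = "\<lambda>x. C\<^sup>2 * (norm (f x))\<^sup>2"])
  show "(norm (s x *\<^sub>R f x))\<^sup>2 \<le> C\<^sup>2 * (norm (f x))\<^sup>2" for x
    using power_mono[OF assms(2)[of x], of 2] by (auto simp: power_mult_distrib intro!: mult_right_mono)
qed (use assms in \<open>auto simp: L2_integrable intro: borel_measurable_scaleR L2_measurable\<close>)

lemma norm_mult_le_sq: "norm x * norm y \<le> (norm x)\<^sup>2 + (norm y)\<^sup>2"
  using sum_squares_bound[of "norm x" "norm y"] zero_le_power2[of "norm x"] zero_le_power2[of "norm y"]
    mult_nonneg_nonneg[OF norm_ge_zero[of x] norm_ge_zero[of y]]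
  by linarith

lemma L2_integrable_inner:
  fixes f g :: "'a::euclidean_space \<Rightarrow> 'b::euclidean_space"
  assumes "f \<in> L2 \<Omega>" "g \<in> L2 \<Omega>"
  shows "integrable (lebesgue_on \<Omega>) (\<lambda>x. f x \<bullet> g x)"
proof (rule Bochner_Integration.integrable_bound)
  show "integrable (lebesgue_on \<Omega>) (\<lambda>x. (norm (f x))\<^sup>2 + (norm (g x))\<^sup>2)"
    using assms by (intro Bochner_Integration.integrable_add L2_integrable)
  show "AE x in lebesgue_on \<Omega>. norm (f x \<bullet> g x) \<le> norm ((norm (f x))\<^sup>2 + (norm (g x))\<^sup>2)"
  proof (rule AE_I2)
    fix x
    show "norm (f x \<bullet> g x) \<le> norm ((norm (f x))\<^sup>2 + (norm (g x))\<^sup>2)"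
      using Cauchy_Schwarz_ineq2[of "f x" "g x"] norm_mult_le_sq[of "f x" "g x"] by simp
  qed
qed (use assms in \<open>auto intro: borel_measurable_inner L2_measurable\<close>)

lemma L2_integrable_scaleR:
  fixes f :: "'a::euclidean_space \<Rightarrow> real" and g :: "'a \<Rightarrow> 'b::euclidean_space"
  assumes "f \<in> L2 \<Omega>" "g \<in> L2 \<Omega>"
  shows "integrable (lebesgue_on \<Omega>) (\<lambda>x. f x *\<^sub>R g x)"
proof (rule Bochner_Integration.integrable_bound)
  show "integrable (lebesgue_on \<Omega>) (\<lambda>x. (norm (f x))\<^sup>2 + (norm (g x))\<^sup>2)"
    using assms by (intro Bochner_Integration.integrable_add L2_integrable)
  show "AE x in lebesgue_on \<Omega>. norm (f x *\<^sub>R g x) \<le> norm ((norm (f x))\<^sup>2 + (norm (g x))\<^sup>2)"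
    using norm_mult_le_sq[of "f _" "g _"] by (intro AE_I2) simp
qed (use assms in \<open>auto intro: borel_measurable_scaleR L2_measurable\<close>)

lemmas L2_integrable_mult = L2_integrable_inner[where 'b = real, unfolded inner_real_def]

text \<open>The square is kept because energies are quadratic, and because
  \<open>sq_norm_add_le\<close> can stand in for the triangle inequality wherever two errors are
  added.\<close>

definition sq_norm :: "'a::euclidean_space set \<Rightarrow> ('a \<Rightarrow> 'b::euclidean_space) \<Rightarrow> real" where
  "sq_norm \<Omega> f = (LINT x|lebesgue_on \<Omega>. (norm (f x))\<^sup>2)"

lemma sq_norm_nonneg: "0 \<le> sq_norm \<Omega> f"
  by (simp add: sq_norm_def)

lemma sq_norm_add_le:
  assumes "f \<in> L2 \<Omega>" "g \<in> L2 \<Omega>"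
  shows "sq_norm \<Omega> (\<lambda>x. f x + g x) \<le> 2 * sq_norm \<Omega> f + 2 * sq_norm \<Omega> g"
proof -
  have "sq_norm \<Omega> (\<lambda>x. f x + g x) \<le> (LINT x|lebesgue_on \<Omega>. 2 * (norm (f x))\<^sup>2 + 2 * (norm (g x))\<^sup>2)"
    unfolding sq_norm_def using assms
    by (intro integral_mono norm_add_sq_le Bochner_Integration.integrable_add integrable_mult_right
        L2_integrable L2_add)
  then show ?thesis
    using assms by (simp add: sq_norm_def L2_integrable)
qed

lemma sq_norm_scaleR: "sq_norm \<Omega> (\<lambda>x. c *\<^sub>R f x) = c\<^sup>2 * sq_norm \<Omega> f"
  by (simp add: sq_norm_def power_mult_distrib)

lemma sq_norm_minus_commute: "sq_norm \<Omega> (\<lambda>x. f x - g x) = sq_norm \<Omega> (\<lambda>x. g x - f x)"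
  by (simp add: sq_norm_def norm_minus_commute)

lemma sq_norm_mono:
  assumes "f \<in> L2 \<Omega>" "g \<in> L2 \<Omega>" "\<And>x. norm (f x) \<le> norm (g x)"
  shows "sq_norm \<Omega> f \<le> sq_norm \<Omega> g"
  unfolding sq_norm_def using assms
  by (intro integral_mono power_mono) (auto intro: L2_integrable)

lemma sq_norm_cong_AE:
  assumes "f \<in> L2 \<Omega>" "g \<in> L2 \<Omega>" "AE x in lebesgue_on \<Omega>. f x = g x"
  shows "sq_norm \<Omega> f = sq_norm \<Omega> g"
  unfolding sq_norm_def using assms
  by (intro integral_cong_AE borel_measurable_integrable L2_integrable) auto

lemma sq_norm_eq_0:
  assumes "f \<in> L2 \<Omega>" "sq_norm \<Omega> f = 0"
  shows "AE x in lebesgue_on \<Omega>. f x = 0"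
  using assms integral_nonneg_eq_0_iff_AE[OF L2_integrable[OF assms(1)]] by (simp add: sq_norm_def)

text \<open>With \<open>t = - 1\<close> this controls the convergence of norms; with free
  \<open>t\<close> it is the expansion behind the Cauchy-Schwarz inequality and behind the first
  variation of the energy.\<close>

lemma sq_norm_linear_combination:
  fixes f g :: "'a::euclidean_space \<Rightarrow> 'b::euclidean_space"
  assumes "f \<in> L2 \<Omega>" "g \<in> L2 \<Omega>"
  shows "sq_norm \<Omega> (\<lambda>x. f x + t *\<^sub>R g x) =
    sq_norm \<Omega> f + 2 * t * (LINT x|lebesgue_on \<Omega>. f x \<bullet> g x) + t\<^sup>2 * sq_norm \<Omega> g"
proof -
  have "(norm (f x + t *\<^sub>R g x))\<^sup>2 = (norm (f x))\<^sup>2 + (2 * t) * (f x \<bullet> g x) + t\<^sup>2 * (norm (g x))\<^sup>2" for x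
    unfolding power2_norm_eq_inner
    by (simp add: inner_add_left inner_add_right inner_commute[of "g x" "f x"] power2_eq_square algebra_simps)
  then show ?thesis
    using assms by (simp add: sq_norm_def L2_integrable L2_integrable_inner)
qed

text \<open>The squared norm of f + t g is a polynomial of degree at most two in t that is never
  negative, so its discriminant cannot be positive.\<close>

lemma L2_Cauchy_Schwarz:
  fixes f g :: "'a::euclidean_space \<Rightarrow> 'b::euclidean_space"
  assumes "f \<in> L2 \<Omega>" "g \<in> L2 \<Omega>"
  shows "(LINT x|lebesgue_on \<Omega>. f x \<bullet> g x)\<^sup>2 \<le> sq_norm \<Omega> f * sq_norm \<Omega> g"
proof -
  define A B C where "A = sq_norm \<Omega> f" and "B = (LINT x|lebesgue_on \<Omega>. f x \<bullet> g x)"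
    and "C = sq_norm \<Omega> g"
  have ineq: "0 \<le> A + 2 * t * B + t\<^sup>2 * C" for t
    using sq_norm_linear_combination[OF assms, of t] sq_norm_nonneg[of \<Omega> "\<lambda>x. f x + t *\<^sub>R g x"]
    by (simp add: A_def B_def C_def)
  have "B\<^sup>2 \<le> A * C"
  proof (cases "C = 0")
    case True
    have lin: "0 \<le> A + 2 * t * B" for t
      using ineq[of t] True by simp
    have "B = 0"
    proof (rule ccontr)
      assume "B \<noteq> 0"
      \<comment> \<open>At this parameter the affine function would take the value -1.\<close>
      then have "2 * (- (A + 1) / (2 * B)) * B = - (A + 1)" by simp
      then show False
        using lin[of "- (A + 1) / (2 * B)"] by linarith
    qed
    then show ?thesis using True by simp
  next
    case False
    then have "C > 0"
      using sq_norm_nonneg[of \<Omega> g] by (simp add: C_def)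
    \<comment> \<open>The quadratic attains its minimum at \<open>- t\<close>.\<close>
    define t where "t = B / C"
    have t: "B = t * C"
      using \<open>C > 0\<close> by (simp add: t_def)
    have "0 \<le> A - t\<^sup>2 * C"
      using ineq[of "- t"] by (simp add: t power2_eq_square mult_ac)
    then have "0 \<le> (A - t\<^sup>2 * C) * C"
      using \<open>C > 0\<close> by (intro mult_nonneg_nonneg) simp_all
    moreover have "(A - t\<^sup>2 * C) * C = A * C - B\<^sup>2"
      by (simp add: t power2_eq_square algebra_simps)
    ultimately show ?thesis by linarith
  qed
  then show ?thesis by (simp add: A_def B_def C_def)
qed

section \<open>Integration and weak gradients on a bounded open set\<close>

locale bounded_open =
  fixes \<Omega> :: "'a::euclidean_space set"
  assumes open_\<Omega>: "open \<Omega>" and bounded_\<Omega>: "bounded \<Omega>"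
begin

abbreviation M :: "'a measure" where "M \<equiv> lebesgue_on \<Omega>"

lemma \<Omega>_lmeasurable: "\<Omega> \<in> lmeasurable"
  using open_\<Omega> bounded_\<Omega> by (simp add: lmeasurable_open)

sublocale finite_measure M
  using \<Omega>_lmeasurable by (rule finite_measure_lebesgue_on)

lemma AE_M_iff: "(AE x in M. P x) \<longleftrightarrow> (AE x in lebesgue. x \<in> \<Omega> \<longrightarrow> P x)"
  using \<Omega>_lmeasurable by (intro AE_restrict_space_iff) (simp add: fmeasurableD)

lemma borel_measurable_M: "f \<in> borel_measurable borel \<Longrightarrow> f \<in> borel_measurable M"
  by (intro measurable_restrict_space1 measurable_completion) simp

lemma integral_M_eq_lborel:
  fixes h :: "'a \<Rightarrow> real"
  assumes "h \<in> borel_measurable borel" "\<And>x. x \<notin> \<Omega> \<Longrightarrow> h x = 0"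
  shows "integral\<^sup>L M h = integral\<^sup>L lborel h"
proof -
  have "(\<lambda>x. indicator \<Omega> x *\<^sub>R h x) = h"
    using assms(2) by (auto simp: indicator_def fun_eq_iff)
  then have "integral\<^sup>L M h = integral\<^sup>L lebesgue h"
    using \<Omega>_lmeasurable by (subst integral_restrict_space) (auto simp: fmeasurableD)
  then show ?thesis
    using assms(1) by (simp add: integral_completion)
qed

text \<open>Constants are square-integrable because a bounded set has finite measure; pairing with
  the constant 1 then makes every L2 function integrable.\<close>

lemma L2_bounded:
  assumes "f \<in> borel_measurable M" "\<And>x. norm (f x) \<le> C"
  shows "f \<in> L2 \<Omega>"
  by (rule L2I_bound[where h = "\<lambda>x. C\<^sup>2"]) (use assms in \<open>auto intro: power_mono\<close>)

lemma L2_imp_integrable: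
  fixes f :: "'a \<Rightarrow> real"
  assumes "f \<in> L2 \<Omega>"
  shows "integrable M f"
  using L2_integrable_mult[OF assms L2_bounded[of "\<lambda>_. 1" 1]] by simp

lemma Cc_infinity_L2: "\<phi> \<in> Cc_infinity \<Omega> \<Longrightarrow> \<phi> \<in> L2 \<Omega>"
  and grad_L2: "\<phi> \<in> Cc_infinity \<Omega> \<Longrightarrow> grad \<phi> \<in> L2 \<Omega>"
proof -
  assume \<phi>: "\<phi> \<in> Cc_infinity \<Omega>"
  then obtain C where "\<And>x. \<bar>\<phi> x\<bar> \<le> C" "\<And>x. norm (grad \<phi> x) \<le> C"
    using Cc_infinity_bounded by metis
  note bounds = this
  show "\<phi> \<in> L2 \<Omega>"
    by (intro L2_bounded[of _ C] borel_measurable_M borel_measurable_continuous_onI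
        Cc_infinity_continuous[OF \<phi>]) (simp add: bounds)
  show "grad \<phi> \<in> L2 \<Omega>"
    by (intro L2_bounded[of _ C] borel_measurable_M borel_measurable_continuous_onI
        Cc_infinity_continuous_grad[OF \<phi>] bounds)
qed

lemma L2_inner_const: "G \<in> L2 \<Omega> \<Longrightarrow> (\<lambda>x. G x \<bullet> b) \<in> L2 \<Omega>"
proof (rule L2I_bound[where h = "\<lambda>x. (norm b)\<^sup>2 * (norm (G x))\<^sup>2"])
  show "(norm (G x \<bullet> b))\<^sup>2 \<le> (norm b)\<^sup>2 * (norm (G x))\<^sup>2" for x
    using Cauchy_Schwarz_ineq[of "G x" b] by (simp add: power2_norm_eq_inner power2_eq_square[of "G x \<bullet> b"] mult.commute)
qed (auto simp: L2_integrable intro: borel_measurable_inner L2_measurable)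

lemma Cc_infinity_integration_by_parts:
  assumes \<phi>: "\<phi> \<in> Cc_infinity \<Omega>" and \<psi>: "\<psi> \<in> Cc_infinity \<Omega>"
  shows "(LINT x|M. \<phi> x * (grad \<psi> x \<bullet> b)) = - (LINT x|M. \<psi> x * (grad \<phi> x \<bullet> b))"
proof -
  obtain K where K: "compact K" "K \<subseteq> \<Omega>" "\<And>x. x \<notin> K \<Longrightarrow> \<phi> x = 0" "\<And>x. x \<notin> K \<Longrightarrow> grad \<phi> x = 0"
    using Cc_infinityE[OF \<phi>] by metis
  let ?g = "\<lambda>x. \<phi> x *\<^sub>R grad \<psi> x + \<psi> x *\<^sub>R grad \<phi> x"
  have D: "((\<lambda>x. \<phi> x * \<psi> x) has_derivative (\<lambda>h. ?g x \<bullet> h)) (at x)" for x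
    using has_derivative_mult[OF Cc_infinity_has_derivative[OF \<phi>] Cc_infinity_has_derivative[OF \<psi>]]
    by (simp add: inner_add_left mult.commute)
  have cont: "continuous_on UNIV (\<lambda>x. ?g x \<bullet> b)"
    by (intro continuous_intros Cc_infinity_continuous[OF \<phi>] Cc_infinity_continuous[OF \<psi>]
        Cc_infinity_continuous_grad[OF \<phi>] Cc_infinity_continuous_grad[OF \<psi>])
  have "(LINT x|lborel. ?g x \<bullet> b) = 0"
    by (rule integral_compact_support_derivative[OF D cont K(1)]) (auto simp: K)
  then have "(LINT x|M. ?g x \<bullet> b) = 0"
    using integral_M_eq_lborel[OF borel_measurable_continuous_onI[OF cont]] K
    by (metis (no_types, lifting) add_cancel_right_right inner_zero_left scaleR_zero_left scaleR_zero_right subsetD)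
  moreover have "(LINT x|M. ?g x \<bullet> b) =
      (LINT x|M. \<phi> x * (grad \<psi> x \<bullet> b)) + (LINT x|M. \<psi> x * (grad \<phi> x \<bullet> b))"
    using \<phi> \<psi>
    by (simp add: inner_add_left L2_integrable_mult Cc_infinity_L2 L2_inner_const grad_L2)
  ultimately show ?thesis by simp
qed

text \<open>Taking inner products with basis vectors turns the vector-valued identity into real
  integrals, to which Cauchy-Schwarz and the fundamental lemma apply.\<close>

lemma is_weak_grad_iff:
  assumes "u \<in> L2 \<Omega>"
  shows "is_weak_grad \<Omega> u G \<longleftrightarrow> G \<in> L2 \<Omega> \<and>
    (\<forall>\<phi>\<in>Cc_infinity \<Omega>. \<forall>b\<in>Basis. (LINT x|M. u x * (grad \<phi> x \<bullet> b)) = - (LINT x|M. \<phi> x * (G x \<bullet> b)))"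
proof -
  have "(LINT x|M. u x *\<^sub>R grad \<phi> x) = - (LINT x|M. \<phi> x *\<^sub>R G x) \<longleftrightarrow>
     (\<forall>b\<in>Basis. (LINT x|M. u x * (grad \<phi> x \<bullet> b)) = - (LINT x|M. \<phi> x * (G x \<bullet> b)))"
    if "G \<in> L2 \<Omega>" "\<phi> \<in> Cc_infinity \<Omega>" for \<phi>
  proof -
    have "(LINT x|M. u x *\<^sub>R grad \<phi> x) \<bullet> b = (LINT x|M. u x * (grad \<phi> x \<bullet> b))" for b
      using integral_inner_left[OF L2_integrable_scaleR[OF assms grad_L2[OF that(2)]], of b]
      by simp
    moreover have "(LINT x|M. \<phi> x *\<^sub>R G x) \<bullet> b = (LINT x|M. \<phi> x * (G x \<bullet> b))" for b
      using integral_inner_left[OF L2_integrable_scaleR[OF Cc_infinity_L2[OF that(2)] that(1)], of b]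
      by simp
    ultimately show ?thesis
      by (simp add: euclidean_eq_iff[where 'a = 'a])
  qed
  then show ?thesis
    unfolding is_weak_grad_def by blast
qed

end

subsection \<open>Uniqueness of weak gradients\<close>

text \<open>Lindelof's theorem, applied to balls whose closures also lie in \<open>V\<close>, so
  that each ball carries a bump function with compact support in \<open>V\<close>. Nonemptiness
  allows an enumeration by all natural numbers, possibly with repetitions.\<close>

lemma open_eq_Union_balls:
  fixes V :: "'a::euclidean_space set"
  assumes "open V" "V \<noteq> {}"
  obtains a :: "nat \<Rightarrow> 'a" and r :: "nat \<Rightarrow> real"
  where "\<forall>n. cball (a n) (r n) \<subseteq> V" "\<forall>n. r n > 0" "(\<Union>n. ball (a n) (r n)) = V"
proof -
  define F where "F = {ball a r | a r. r > 0 \<and> cball a r \<subseteq> V}"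
  obtain F' where F': "F' \<subseteq> F" "countable F'" "\<Union>F' = \<Union>F"
    by (rule Lindelof[of F]) (auto simp: F_def)
  have "\<Union>F = V"
  proof
    show "\<Union>F \<subseteq> V"
      using ball_subset_cball by (fastforce simp: F_def)
    show "V \<subseteq> \<Union>F"
    proof
      fix x assume "x \<in> V"
      then obtain r where "r > 0" "cball x r \<subseteq> V"
        using assms(1) open_contains_cball by blast
      then show "x \<in> \<Union>F"
        by (intro UnionI[of "ball x r"]) (auto simp: F_def)
    qed
  qed
  with F' assms(2) have "F' \<noteq> {}" by auto
  then have range: "range (from_nat_into F') = F'"
    using F'(2) by (rule range_from_nat_into)
  have "\<exists>a r. from_nat_into F' n = ball a r \<and> r > 0 \<and> cball a r \<subseteq> V" for n
    using from_nat_into[OF \<open>F' \<noteq> {}\<close>, of n] F'(1) by (auto simp: F_def)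
  then obtain a r where "\<And>n. from_nat_into F' n = ball (a n) (r n) \<and> r n > 0 \<and> cball (a n) (r n) \<subseteq> V"
    by metis
  then show thesis
    using range F'(3) \<open>\<Union>F = V\<close> by (intro that[of a r]) auto
qed

text \<open>By 1 - fg = (1 - f) + f (1 - g). Functions equal to 1 off a compact subset of
  \<open>\<Omega>\<close> are thus closed under products, although they are not compactly supported
  in general.\<close>

lemma Cc_infinity_one_minus_mult:
  assumes "(\<lambda>x. 1 - f x) \<in> Cc_infinity \<Omega>" "(\<lambda>x. 1 - g x) \<in> Cc_infinity \<Omega>"
  shows "(\<lambda>x. 1 - f x * g x) \<in> Cc_infinity \<Omega>"
proof -
  have "C_diff j (\<lambda>x. 1 + (-1) * (1 - f x))" for j
    by (intro C_diff_add C_diff_mult C_diff_const Cc_infinity_C_diff[OF assms(1)])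
  then have "C_diff j f" for j
    by simp
  then have "(\<lambda>x. (1 - f x) + f x * (1 - g x)) \<in> Cc_infinity \<Omega>"
    by (intro Cc_infinity_add Cc_infinity_mult assms)
  then show ?thesis
    by (simp add: algebra_simps)
qed

text \<open>The approximants are 1 - P_n^n, where P_n is the product of 1 - b_i over the first n
  bumps b_i of a countable family of balls covering \<open>V\<close>. Off \<open>V\<close> the
  product is 1. At a point of \<open>V\<close> it eventually stays below a fixed number less than 1,
  and the growing power sends it to 0.\<close>

lemma Cc_infinity_approx_indicator:
  assumes "open V" "V \<subseteq> \<Omega>"
  obtains \<theta> :: "nat \<Rightarrow> 'a::euclidean_space \<Rightarrow> real"
  where "\<And>n. \<theta> n \<in> Cc_infinity \<Omega>" "\<And>n x. \<bar>\<theta> n x\<bar> \<le> 1"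
    "\<And>x. (\<lambda>n. \<theta> n x) \<longlonglongrightarrow> indicator V x"
proof (cases "V = {}")
  case True
  then show thesis
    by (intro that[of "\<lambda>_ _. 0"]) (auto simp: Cc_infinity_zero)
next
  case False
  obtain a :: "nat \<Rightarrow> 'a" and r :: "nat \<Rightarrow> real"
    where "\<forall>n. cball (a n) (r n) \<subseteq> V" "\<forall>n. r n > 0"
      and V: "(\<Union>n. ball (a n) (r n)) = V"
    by (rule open_eq_Union_balls[OF assms(1) False])
  then have ar: "\<And>n. cball (a n) (r n) \<subseteq> V" "\<And>n. r n > 0"
    by blast+
  define p where "p n x = (\<Prod>i<n. (1 - bump (a i) (r i) x))" for n x
  have p: "0 \<le> p n x" "p n x \<le> 1" for n x
    unfolding p_def by (auto intro!: prod_nonneg prod_le_1 simp: bump_nonneg bump_le_1)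
  have one: "(\<lambda>x. 1 - 1) \<in> Cc_infinity \<Omega>"
    by (simp add: Cc_infinity_zero)
  have "(\<lambda>x. 1 - (\<Prod>i<n. (1 - bump (a i) (r i) x))) \<in> Cc_infinity \<Omega>" for n
  proof (induction n)
    case 0
    then show ?case using one by simp
  next
    case (Suc n)
    have "(\<lambda>x. 1 - (1 - bump (a n) (r n) x)) \<in> Cc_infinity \<Omega>"
      using Cc_infinity_bump[OF ar(2), of "a n" n \<Omega>] ar(1)[of n] assms(2) by simp
    from Cc_infinity_one_minus_mult[OF Suc this] show ?case
      by simp
  qed
  then have pCc: "(\<lambda>x. 1 - p n x) \<in> Cc_infinity \<Omega>" for n
    by (simp add: p_def)
  have "(\<lambda>x. 1 - p n x ^ k) \<in> Cc_infinity \<Omega>" for n k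
  proof (induction k)
    case 0
    then show ?case using one by simp
  next
    case (Suc k)
    from Cc_infinity_one_minus_mult[OF pCc[of n] Suc] show ?case
      by simp
  qed
  moreover have "\<bar>1 - p n x ^ n\<bar> \<le> 1" for n x
    using p[of n x] power_le_one[of "p n x" n] zero_le_power[of "p n x" n] by simp
  moreover have "(\<lambda>n. 1 - p n x ^ n) \<longlonglongrightarrow> indicator V x" for x
  proof (cases "x \<in> V")
    case True
    then obtain i where i: "x \<in> ball (a i) (r i)"
      using V by blast
    define q where "q = 1 - bump (a i) (r i) x"
    have q: "0 \<le> q" "q < 1"
      using i bump_pos_iff[OF ar(2)[of i], of "a i" x] bump_le_1[of "a i" "r i" x]
      by (simp_all add: q_def)
    \<comment> \<open>Once the factor with index \<open>i\<close> has entered the product, the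
      remaining factors, all in [0,1], can only decrease it; \<open>q\<close> does not depend on
      \<open>n\<close>.\<close>
    have "p n x ^ n \<le> q ^ n" if "n > i" for n
    proof -
      have "p n x = q * (\<Prod>j\<in>{..<n} - {i}. (1 - bump (a j) (r j) x))"
        unfolding p_def q_def using that by (intro prod.remove) auto
      also have "\<dots> \<le> q * 1"
        using q by (intro mult_left_mono prod_le_1) (auto simp: bump_nonneg bump_le_1)
      finally show ?thesis
        using p by (intro power_mono) simp_all
    qed
    then have upper: "\<forall>\<^sub>F n in sequentially. p n x ^ n \<le> q ^ n"
      by (rule eventually_mono[OF eventually_gt_at_top])
    have lower: "\<forall>\<^sub>F n in sequentially. 0 \<le> p n x ^ n"
      by (intro always_eventually allI zero_le_power p)
    have "(\<lambda>n. p n x ^ n) \<longlonglongrightarrow> 0"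
      by (rule real_tendsto_sandwich[OF lower upper tendsto_const LIMSEQ_realpow_zero[OF q]])
    then have "(\<lambda>n. 1 - p n x ^ n) \<longlonglongrightarrow> 1 - 0"
      by (intro tendsto_intros)
    with True show ?thesis by simp
  next
    case False
    then have "x \<notin> ball (a i) (r i)" for i
      using V by blast
    then have "\<not> 0 < bump (a i) (r i) x" for i
      by (simp only: bump_pos_iff[OF ar(2)] not_False_eq_True)
    then have "bump (a i) (r i) x = 0" for i
      using bump_nonneg[of "a i" "r i" x] by (meson linorder_not_less order_antisym)
    with False show ?thesis
      by (simp add: p_def)
  qed
  ultimately show thesis
    by (rule that)
qed

context bounded_open
begin

text \<open>Orthogonality to test functions extends to indicators of open sets by approximation,
  then to closed subsets of \<open>\<Omega>\<close> by complements. Up to a null set, the region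
  where \<open>g\<close> is positive is a countable union of closed sets, so it suffices to treat
  those. No mollification is used.\<close>

lemma AE_nonpos_of_orthogonal:
  fixes g :: "'a \<Rightarrow> real"
  assumes g: "g \<in> L2 \<Omega>" and orth: "\<And>\<phi>. \<phi> \<in> Cc_infinity \<Omega> \<Longrightarrow> (LINT x|M. \<phi> x * g x) = 0"
  shows "AE x in M. g x \<le> 0"
proof -
  have int: "integrable M g"
    using g by (rule L2_imp_integrable)
  note [measurable] = L2_measurable[OF g]
  have open0: "(LINT x|M. indicator V x * g x) = 0" if V: "open V" "V \<subseteq> \<Omega>" for V
  proof -
    obtain \<theta> where \<theta>: "\<And>n. \<theta> n \<in> Cc_infinity \<Omega>" "\<And>n x. \<bar>\<theta> n x\<bar> \<le> 1"
        "\<And>x. (\<lambda>n. \<theta> n x) \<longlonglongrightarrow> indicator V x"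
      using that by (rule Cc_infinity_approx_indicator[OF V])
    have [measurable]: "\<theta> n \<in> borel_measurable M" for n
      by (intro L2_measurable Cc_infinity_L2 \<theta>)
    have [measurable]: "V \<in> sets M"
      using V \<Omega>_lmeasurable by (subst sets_restrict_space_iff) (auto simp: fmeasurableD)
    have "(\<lambda>n. LINT x|M. \<theta> n x * g x) \<longlonglongrightarrow> (LINT x|M. indicator V x * g x)"
    proof (rule integral_dominated_convergence[where w = "\<lambda>x. \<bar>g x\<bar>"])
      show "AE x in M. (\<lambda>n. \<theta> n x * g x) \<longlonglongrightarrow> indicator V x * g x"
        by (intro AE_I2 tendsto_intros \<theta>)
      show "AE x in M. norm (\<theta> n x * g x) \<le> \<bar>g x\<bar>" for n
        by (intro AE_I2) (simp add: abs_mult mult_left_le_one_le \<theta>)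
    qed (use int in simp_all)
    then show ?thesis
      using orth[OF \<theta>(1)] by (simp add: LIMSEQ_const_iff)
  qed
  \<comment> \<open>The indicator of \<open>C\<close> is that of \<open>\<Omega>\<close> minus that
    of the open set \<open>\<Omega> - C\<close>, so \<open>g\<close> integrates to zero over
    \<open>C\<close>; being positive there, it forces \<open>C\<close> to be null.\<close>
  have closed0: "AE x in M. x \<notin> C" if C: "closed C" "C \<subseteq> {x \<in> \<Omega>. g x > 0}" for C
  proof -
    have [measurable]: "C \<in> sets M"
      using C \<Omega>_lmeasurable by (subst sets_restrict_space_iff) (auto simp: fmeasurableD)
    have intC: "integrable M (\<lambda>x. indicator A x * g x)" if "A \<in> sets M" for A
      using integrable_mult_indicator[OF that int] by simp
    have set: "\<Omega> - C \<in> sets M" "\<Omega> \<in> sets M"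
      using \<open>C \<in> sets M\<close> by auto
    have "(LINT x|M. indicator C x * g x) = (LINT x|M. indicator \<Omega> x * g x - indicator (\<Omega> - C) x * g x)"
      by (intro Bochner_Integration.integral_cong) (auto simp: indicator_def)
    also have "\<dots> = 0"
      using open0[OF open_\<Omega>] open0[of "\<Omega> - C"] C(1) open_\<Omega>
      by (simp add: intC set open_Diff)
    finally have zero: "(LINT x|M. indicator C x * g x) = 0" .
    have "AE x in M. 0 \<le> indicator C x * g x"
      using C(2) by (intro AE_I2) (auto simp: indicator_def)
    from integral_nonneg_eq_0_iff_AE[THEN iffD1, OF intC[OF \<open>C \<in> sets M\<close>] this zero]
    have "AE x in M. indicator C x * g x = 0" .
    then show ?thesis
      by eventually_elim (use C(2) in \<open>auto simp: indicator_def\<close>)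
  qed
  have "{x \<in> space M. g x > 0} \<in> sets M"
    by measurable
  then have "{x \<in> \<Omega>. g x > 0} \<in> sets M"
    by simp
  then have "{x \<in> \<Omega>. g x > 0} \<in> sets lebesgue"
    using \<Omega>_lmeasurable by (subst (asm) sets_restrict_space_iff) (auto simp: fmeasurableD)
  then obtain C T where CT: "fsigma C" "T \<in> null_sets lebesgue" "C \<union> T = {x \<in> \<Omega>. g x > 0}"
    by (rule lebesgue_set_almost_fsigma)
  from CT(1) obtain F :: "nat \<Rightarrow> 'a set" where F: "\<And>n. closed (F n)" "C = (\<Union>n. F n)"
    by (cases rule: fsigma.cases) auto
  have "AE x in M. \<forall>n. x \<notin> F n"
  proof (subst AE_all_countable, rule allI)
    fix n
    have "F n \<subseteq> {x \<in> \<Omega>. g x > 0}"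
      using F(2) CT(3) by blast
    with F(1) show "AE x in M. x \<notin> F n"
      by (rule closed0)
  qed
  moreover have "AE x in M. x \<notin> T"
    unfolding AE_M_iff using AE_not_in[OF CT(2)] by eventually_elim simp
  moreover have "AE x in M. x \<in> \<Omega>"
    using AE_space[of M] by simp
  ultimately show ?thesis
  proof eventually_elim
    case (elim x)
    then have "x \<notin> C \<union> T" using F(2) by blast
    with elim CT(3) show ?case by auto
  qed
qed

lemma fundamental_lemma:
  fixes g :: "'a \<Rightarrow> real"
  assumes g: "g \<in> L2 \<Omega>" and orth: "\<And>\<phi>. \<phi> \<in> Cc_infinity \<Omega> \<Longrightarrow> (LINT x|M. \<phi> x * g x) = 0"
  shows "AE x in M. g x = 0"
proof -
  have "AE x in M. g x \<le> 0"
    by (rule AE_nonpos_of_orthogonal[OF g orth])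
  moreover have "AE x in M. - g x \<le> 0"
    using L2_cmult[OF g, of "-1"] orth by (intro AE_nonpos_of_orthogonal) simp_all
  ultimately show ?thesis
    by eventually_elim simp
qed

text \<open>This is what identifies the chosen \<open>weak_grad\<close> with any gradient found by
  calculation. The fundamental lemma is applied to each of the finitely many components.\<close>

lemma is_weak_grad_unique:
  assumes u: "u \<in> L2 \<Omega>" and "is_weak_grad \<Omega> u G" "is_weak_grad \<Omega> u H"
  shows "AE x in M. G x = H x"
proof -
  have weak: "(LINT x|M. u x * (grad \<phi> x \<bullet> b)) = - (LINT x|M. \<phi> x * (K x \<bullet> b))"
    if "is_weak_grad \<Omega> u K" "\<phi> \<in> Cc_infinity \<Omega>" "b \<in> Basis" for K \<phi> b
    using that(1)[unfolded is_weak_grad_iff[OF u]] that(2,3) by blast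
  have eq: "(LINT x|M. \<phi> x * (G x \<bullet> b)) = (LINT x|M. \<phi> x * (H x \<bullet> b))"
    if "\<phi> \<in> Cc_infinity \<Omega>" "b \<in> Basis" for \<phi> b
    using weak[OF assms(2) that] weak[OF assms(3) that] by linarith
  have GH: "G \<in> L2 \<Omega>" "H \<in> L2 \<Omega>"
    using assms(2,3) by (auto simp: is_weak_grad_def)
  have "AE x in M. G x \<bullet> b - H x \<bullet> b = 0" if b: "b \<in> Basis" for b
  proof (rule fundamental_lemma)
    show "(\<lambda>x. G x \<bullet> b - H x \<bullet> b) \<in> L2 \<Omega>"
      by (intro L2_diff L2_inner_const GH)
    show "(LINT x|M. \<phi> x * (G x \<bullet> b - H x \<bullet> b)) = 0" if "\<phi> \<in> Cc_infinity \<Omega>" for \<phi>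
      using eq[OF that b] by (simp add: right_diff_distrib L2_integrable_mult Cc_infinity_L2 L2_inner_const GH that)
  qed
  then have "AE x in M. \<forall>b\<in>Basis. G x \<bullet> b - H x \<bullet> b = 0"
    by (intro AE_finite_allI) auto
  then show ?thesis
    by eventually_elim (simp add: euclidean_eq_iff[where 'a = 'a])
qed

end

subsection \<open>The closure of the test functions\<close>

lemma abs_smooth_pos_diff_le:
  assumes "e > 0"
  shows "\<bar>smooth_pos e a - smooth_pos e b\<bar> \<le> \<bar>a - b\<bar>"
proof -
  have *: "\<bar>smooth_pos e b - smooth_pos e a\<bar> \<le> b - a" if "a < b" for a b
  proof -
    have "\<exists>z>a. z < b \<and> smooth_pos e b - smooth_pos e a = (b - a) * smooth_pos' e z"
      by (rule MVT2[OF that DERIV_smooth_pos])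
    then obtain z where "smooth_pos e b - smooth_pos e a = (b - a) * smooth_pos' e z"
      by blast
    then show ?thesis
      using smooth_pos'_bounds[OF assms, of z] that by (simp add: abs_mult mult_left_le)
  qed
  show ?thesis
    using *[of a b] *[of b a] by (cases a b rule: linorder_cases) (simp_all add: abs_minus_commute)
qed

lemma L2_inner_tendsto:
  fixes f :: "nat \<Rightarrow> 'a::euclidean_space \<Rightarrow> 'b::euclidean_space"
  assumes f: "\<And>n. f n \<in> L2 \<Omega>" "f' \<in> L2 \<Omega>" and g: "g \<in> L2 \<Omega>"
    and lim: "(\<lambda>n. sq_norm \<Omega> (\<lambda>x. f n x - f' x)) \<longlonglongrightarrow> 0"
  shows "(\<lambda>n. LINT x|lebesgue_on \<Omega>. f n x \<bullet> g x) \<longlonglongrightarrow> (LINT x|lebesgue_on \<Omega>. f' x \<bullet> g x)"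
proof -
  have "(\<lambda>n. (LINT x|lebesgue_on \<Omega>. f n x \<bullet> g x) - (LINT x|lebesgue_on \<Omega>. f' x \<bullet> g x)) \<longlonglongrightarrow> 0"
  proof (rule Lim_null_comparison)
    have "\<bar>(LINT x|lebesgue_on \<Omega>. f n x \<bullet> g x) - (LINT x|lebesgue_on \<Omega>. f' x \<bullet> g x)\<bar>
        \<le> sqrt (sq_norm \<Omega> (\<lambda>x. f n x - f' x) * sq_norm \<Omega> g)" for n
    proof -
      have "(LINT x|lebesgue_on \<Omega>. f n x \<bullet> g x) - (LINT x|lebesgue_on \<Omega>. f' x \<bullet> g x)
          = (LINT x|lebesgue_on \<Omega>. (f n x - f' x) \<bullet> g x)"
        by (simp add: inner_diff_left L2_integrable_inner f g)
      then show ?thesis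
        using real_sqrt_le_mono[OF L2_Cauchy_Schwarz[OF L2_diff[OF f(1)[of n] f(2)] g]]
        by (simp only: real_sqrt_abs)
    qed
    then show "\<forall>\<^sub>F n in sequentially. norm ((LINT x|lebesgue_on \<Omega>. f n x \<bullet> g x) - (LINT x|lebesgue_on \<Omega>. f' x \<bullet> g x))
        \<le> sqrt (sq_norm \<Omega> (\<lambda>x. f n x - f' x) * sq_norm \<Omega> g)"
      by (intro always_eventually allI) simp
    have "(\<lambda>n. sqrt (sq_norm \<Omega> (\<lambda>x. f n x - f' x) * sq_norm \<Omega> g)) \<longlonglongrightarrow> sqrt (0 * sq_norm \<Omega> g)"
      by (rule tendsto_real_sqrt[OF tendsto_mult_right[OF lim]])
    then show "(\<lambda>n. sqrt (sq_norm \<Omega> (\<lambda>x. f n x - f' x) * sq_norm \<Omega> g)) \<longlonglongrightarrow> 0"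
      by simp
  qed
  then show ?thesis
    by (rule LIM_zero_cancel)
qed

text \<open>The squared norm of f_n equals 2 <f_n, f'> - |f'|^2 + |f_n - f'|^2, so convergence of
  inner products suffices.\<close>

lemma sq_norm_tendsto:
  fixes f :: "nat \<Rightarrow> 'a::euclidean_space \<Rightarrow> 'b::euclidean_space"
  assumes f: "\<And>n. f n \<in> L2 \<Omega>" "f' \<in> L2 \<Omega>"
    and lim: "(\<lambda>n. sq_norm \<Omega> (\<lambda>x. f n x - f' x)) \<longlonglongrightarrow> 0"
  shows "(\<lambda>n. sq_norm \<Omega> (f n)) \<longlonglongrightarrow> sq_norm \<Omega> f'"
proof -
  have eq: "sq_norm \<Omega> (f n) = 2 * (LINT x|lebesgue_on \<Omega>. f n x \<bullet> f' x) - sq_norm \<Omega> f'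
      + sq_norm \<Omega> (\<lambda>x. f n x - f' x)" for n
    using sq_norm_linear_combination[OF f(1)[of n] f(2), of "- 1"] by simp
  have "(\<lambda>n. 2 * (LINT x|lebesgue_on \<Omega>. f n x \<bullet> f' x) - sq_norm \<Omega> f'
      + sq_norm \<Omega> (\<lambda>x. f n x - f' x)) \<longlonglongrightarrow>
      2 * (LINT x|lebesgue_on \<Omega>. f' x \<bullet> f' x) - sq_norm \<Omega> f' + 0"
    by (intro tendsto_intros L2_inner_tendsto f lim)
  moreover have "(LINT x|lebesgue_on \<Omega>. f' x \<bullet> f' x) = sq_norm \<Omega> f'"
    by (simp add: sq_norm_def power2_norm_eq_inner)
  ultimately show ?thesis
    by (simp add: eq)
qed

lemma sq_norm_tendsto_linear:
  fixes f g :: "nat \<Rightarrow> 'a::euclidean_space \<Rightarrow> 'b::euclidean_space"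
  assumes f: "\<And>n. f n \<in> L2 \<Omega>" "f' \<in> L2 \<Omega>" and g: "\<And>n. g n \<in> L2 \<Omega>" "g' \<in> L2 \<Omega>"
    and lim: "(\<lambda>n. sq_norm \<Omega> (\<lambda>x. f n x - f' x)) \<longlonglongrightarrow> 0" "(\<lambda>n. sq_norm \<Omega> (\<lambda>x. g n x - g' x)) \<longlonglongrightarrow> 0"
  shows "(\<lambda>n. sq_norm \<Omega> (\<lambda>x. (f n x + c *\<^sub>R g n x) - (f' x + c *\<^sub>R g' x))) \<longlonglongrightarrow> 0"
proof (rule real_tendsto_sandwich[OF _ _ tendsto_const])
  let ?h = "\<lambda>n. 2 * sq_norm \<Omega> (\<lambda>x. f n x - f' x) + 2 * (c\<^sup>2 * sq_norm \<Omega> (\<lambda>x. g n x - g' x))"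
  have "(f n x + c *\<^sub>R g n x) - (f' x + c *\<^sub>R g' x) = (f n x - f' x) + c *\<^sub>R (g n x - g' x)" for n x
    by (simp add: scaleR_diff_right)
  then have "sq_norm \<Omega> (\<lambda>x. (f n x + c *\<^sub>R g n x) - (f' x + c *\<^sub>R g' x)) \<le> ?h n" for n
    using sq_norm_add_le[OF L2_diff[OF f(1)[of n] f(2)] L2_scaleR[OF L2_diff[OF g(1)[of n] g(2)], of c]]
    by (simp only: sq_norm_scaleR)
  then show "\<forall>\<^sub>F n in sequentially. sq_norm \<Omega> (\<lambda>x. (f n x + c *\<^sub>R g n x) - (f' x + c *\<^sub>R g' x)) \<le> ?h n"
    by (intro always_eventually allI)
  have "?h \<longlonglongrightarrow> 2 * 0 + 2 * (c\<^sup>2 * 0)"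
    by (intro tendsto_add tendsto_mult_left lim)
  then show "?h \<longlonglongrightarrow> 0" by simp
qed (simp add: sq_norm_nonneg)

section \<open>Zero-trace Sobolev functions with an explicit gradient\<close>

context bounded_open
begin

text \<open>Membership in \<open>H01\<close> together with a witness \<open>G\<close> for the
  gradient, as a joint L2 limit of test functions. Linear operations and the chain rule act on such
  pairs directly, without reference to the choice made in \<open>weak_grad\<close>.\<close>

definition H01_pair :: "('a \<Rightarrow> real) \<Rightarrow> ('a \<Rightarrow> 'a) \<Rightarrow> bool" where
  "H01_pair u G \<longleftrightarrow> u \<in> L2 \<Omega> \<and> G \<in> L2 \<Omega> \<and> (\<forall>x. x \<notin> \<Omega> \<longrightarrow> u x = 0) \<and>
     (\<exists>\<phi>. (\<forall>n::nat. \<phi> n \<in> Cc_infinity \<Omega>) \<and>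
       (\<lambda>n. sq_norm \<Omega> (\<lambda>x. \<phi> n x - u x)) \<longlonglongrightarrow> 0 \<and>
       (\<lambda>n. sq_norm \<Omega> (\<lambda>x. grad (\<phi> n) x - G x)) \<longlonglongrightarrow> 0)"

lemma H01_pairD:
  assumes "H01_pair u G"
  shows "u \<in> L2 \<Omega>" "G \<in> L2 \<Omega>" "x \<notin> \<Omega> \<Longrightarrow> u x = 0"
  using assms by (auto simp: H01_pair_def)

lemma H01_pairI:
  assumes "u \<in> L2 \<Omega>" "G \<in> L2 \<Omega>" "\<And>x. x \<notin> \<Omega> \<Longrightarrow> u x = 0" "\<And>n::nat. \<phi> n \<in> Cc_infinity \<Omega>"
    "(\<lambda>n. sq_norm \<Omega> (\<lambda>x. \<phi> n x - u x)) \<longlonglongrightarrow> 0"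
    "(\<lambda>n. sq_norm \<Omega> (\<lambda>x. grad (\<phi> n) x - G x)) \<longlonglongrightarrow> 0"
  shows "H01_pair u G"
  unfolding H01_pair_def using assms by (intro conjI allI impI exI[of _ \<phi>]) simp_all

lemma H01_pairE:
  assumes "H01_pair u G"
  obtains \<phi> :: "nat \<Rightarrow> 'a \<Rightarrow> real" where "\<And>n. \<phi> n \<in> Cc_infinity \<Omega>"
    "(\<lambda>n. sq_norm \<Omega> (\<lambda>x. \<phi> n x - u x)) \<longlonglongrightarrow> 0"
    "(\<lambda>n. sq_norm \<Omega> (\<lambda>x. grad (\<phi> n) x - G x)) \<longlonglongrightarrow> 0"
  using assms by (auto simp: H01_pair_def)

lemma Cc_infinity_outside: "\<phi> \<in> Cc_infinity \<Omega> \<Longrightarrow> x \<notin> \<Omega> \<Longrightarrow> \<phi> x = 0"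
  by (rule Cc_infinityE[of \<phi> \<Omega>]) auto

lemma H01_pair_Cc_infinity: "\<phi> \<in> Cc_infinity \<Omega> \<Longrightarrow> H01_pair \<phi> (grad \<phi>)"
  unfolding H01_pair_def
  by (intro conjI exI[of _ "\<lambda>_. \<phi>"]) (auto simp: Cc_infinity_L2 grad_L2 Cc_infinity_outside sq_norm_def)

lemma H01_pair_linear:
  assumes "H01_pair u G" "H01_pair v H"
  shows "H01_pair (\<lambda>x. u x + c * v x) (\<lambda>x. G x + c *\<^sub>R H x)"
proof -
  obtain \<phi> :: "nat \<Rightarrow> 'a \<Rightarrow> real" where \<phi>: "\<And>n. \<phi> n \<in> Cc_infinity \<Omega>"
    "(\<lambda>n. sq_norm \<Omega> (\<lambda>x. \<phi> n x - u x)) \<longlonglongrightarrow> 0"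
    "(\<lambda>n. sq_norm \<Omega> (\<lambda>x. grad (\<phi> n) x - G x)) \<longlonglongrightarrow> 0"
    using that by (rule H01_pairE[OF assms(1)])
  obtain \<psi> :: "nat \<Rightarrow> 'a \<Rightarrow> real" where \<psi>: "\<And>n. \<psi> n \<in> Cc_infinity \<Omega>"
    "(\<lambda>n. sq_norm \<Omega> (\<lambda>x. \<psi> n x - v x)) \<longlonglongrightarrow> 0"
    "(\<lambda>n. sq_norm \<Omega> (\<lambda>x. grad (\<psi> n) x - H x)) \<longlonglongrightarrow> 0"
    using that by (rule H01_pairE[OF assms(2)])
  note u = H01_pairD[OF assms(1)] and v = H01_pairD[OF assms(2)]
  have Cc: "(\<lambda>x. \<phi> n x + c * \<psi> n x) \<in> Cc_infinity \<Omega>" for n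
    by (rule Cc_infinity_add[OF \<phi>(1) Cc_infinity_cmult[OF \<psi>(1)]])
  have "(\<lambda>n. sq_norm \<Omega> (\<lambda>x. (\<phi> n x + c *\<^sub>R \<psi> n x) - (u x + c *\<^sub>R v x))) \<longlonglongrightarrow> 0"
    by (rule sq_norm_tendsto_linear[OF Cc_infinity_L2[OF \<phi>(1)] u(1) Cc_infinity_L2[OF \<psi>(1)] v(1) \<phi>(2) \<psi>(2)])
  then have "(\<lambda>n. sq_norm \<Omega> (\<lambda>x. (\<phi> n x + c * \<psi> n x) - (u x + c * v x))) \<longlonglongrightarrow> 0"
    by (simp only: real_scaleR_def)
  moreover
  have grad: "grad (\<lambda>x. \<phi> n x + c * \<psi> n x) x = grad (\<phi> n) x + c *\<^sub>R grad (\<psi> n) x" for n x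
    by (simp only: grad_add[OF \<phi>(1) Cc_infinity_cmult[OF \<psi>(1)]] grad_cmult[OF \<psi>(1)])
  have "(\<lambda>n. sq_norm \<Omega> (\<lambda>x. grad (\<lambda>x. \<phi> n x + c * \<psi> n x) x - (G x + c *\<^sub>R H x))) \<longlonglongrightarrow> 0"
    unfolding grad
    by (rule sq_norm_tendsto_linear[OF grad_L2[OF \<phi>(1)] u(2) grad_L2[OF \<psi>(1)] v(2) \<phi>(3) \<psi>(3)])
  ultimately show ?thesis
    using Cc u v by (intro H01_pairI[of _ _ "\<lambda>n x. \<phi> n x + c * \<psi> n x"] L2_add L2_cmult L2_scaleR) simp_all
qed

text \<open>Integration by parts holds for the approximating test functions, and both sides are
  continuous under L2 convergence of the functions and their gradients.\<close>

lemma H01_pair_weak: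
  assumes "H01_pair u G" and \<psi>: "\<psi> \<in> Cc_infinity \<Omega>"
  shows "(LINT x|M. u x * (grad \<psi> x \<bullet> b)) = - (LINT x|M. \<psi> x * (G x \<bullet> b))"
proof -
  obtain \<phi> :: "nat \<Rightarrow> 'a \<Rightarrow> real" where \<phi>: "\<And>n. \<phi> n \<in> Cc_infinity \<Omega>"
    "(\<lambda>n. sq_norm \<Omega> (\<lambda>x. \<phi> n x - u x)) \<longlonglongrightarrow> 0"
    "(\<lambda>n. sq_norm \<Omega> (\<lambda>x. grad (\<phi> n) x - G x)) \<longlonglongrightarrow> 0"
    using that by (rule H01_pairE[OF assms(1)])
  note u = H01_pairD[OF assms(1)]
  have "(\<lambda>n. LINT x|M. \<phi> n x \<bullet> (grad \<psi> x \<bullet> b)) \<longlonglongrightarrow> (LINT x|M. u x \<bullet> (grad \<psi> x \<bullet> b))"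
    by (intro L2_inner_tendsto \<phi> u L2_inner_const grad_L2 Cc_infinity_L2 \<psi>)
  moreover
  have \<psi>b: "(\<lambda>x. \<psi> x *\<^sub>R b) \<in> L2 \<Omega>"
    using L2_integrable[OF Cc_infinity_L2[OF \<psi>]] L2_measurable[OF Cc_infinity_L2[OF \<psi>]]
    by (intro L2I_bound[where h = "\<lambda>x. (norm (\<psi> x))\<^sup>2 * (norm b)\<^sup>2"] borel_measurable_scaleR)
       (auto simp: power_mult_distrib)
  have "(\<lambda>n. LINT x|M. grad (\<phi> n) x \<bullet> (\<psi> x *\<^sub>R b)) \<longlonglongrightarrow> (LINT x|M. G x \<bullet> (\<psi> x *\<^sub>R b))"
    by (intro L2_inner_tendsto \<phi> u \<psi>b grad_L2)
  then have "(\<lambda>n. - (LINT x|M. grad (\<phi> n) x \<bullet> (\<psi> x *\<^sub>R b))) \<longlonglongrightarrow> - (LINT x|M. G x \<bullet> (\<psi> x *\<^sub>R b))"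
    by (rule tendsto_minus)
  ultimately show ?thesis
    using Cc_infinity_integration_by_parts[OF \<phi>(1) \<psi>, of _ b] LIMSEQ_unique by simp
qed

lemma H01_pair_is_weak_grad: "H01_pair u G \<Longrightarrow> is_weak_grad \<Omega> u G"
  using H01_pair_weak by (simp add: is_weak_grad_iff H01_pairD)

lemma is_weak_grad_weak_grad: "is_weak_grad \<Omega> u G \<Longrightarrow> is_weak_grad \<Omega> u (weak_grad \<Omega> u)"
  unfolding weak_grad_def by (rule someI[where P = "is_weak_grad \<Omega> u"])

lemma weak_grad_AE:
  assumes "u \<in> L2 \<Omega>" "is_weak_grad \<Omega> u G"
  shows "AE x in M. weak_grad \<Omega> u x = G x" "weak_grad \<Omega> u \<in> L2 \<Omega>"
  using is_weak_grad_unique[OF assms(1) is_weak_grad_weak_grad[OF assms(2)] assms(2)]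
    is_weak_grad_weak_grad[OF assms(2)]
  by (auto simp: is_weak_grad_def)

lemma H1_norm_eq:
  assumes "u \<in> L2 \<Omega>" "is_weak_grad \<Omega> u G"
  shows "H1_norm \<Omega> u = sqrt (sq_norm \<Omega> u + sq_norm \<Omega> G)"
proof -
  have "G \<in> L2 \<Omega>"
    using assms(2) by (simp add: is_weak_grad_def)
  from sq_norm_cong_AE[OF weak_grad_AE(2)[OF assms] this weak_grad_AE(1)[OF assms]] show ?thesis
    by (simp add: H1_norm_def sq_norm_def)
qed

text \<open>\<open>H1_norm\<close> of a difference refers to the chosen weak gradient of that
  difference, so a gradient of it has to be exhibited before the norm can be computed.\<close>

lemma is_weak_grad_diff:
  assumes u: "u \<in> L2 \<Omega>" "is_weak_grad \<Omega> u G" and \<phi>: "\<phi> \<in> Cc_infinity \<Omega>"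
  shows "is_weak_grad \<Omega> (\<lambda>x. u x - \<phi> x) (\<lambda>x. G x - grad \<phi> x)"
proof -
  have G: "G \<in> L2 \<Omega>"
    using u(2) by (simp add: is_weak_grad_def)
  have "(LINT x|M. (u x - \<phi> x) * (grad \<psi> x \<bullet> b)) = - (LINT x|M. \<psi> x * ((G x - grad \<phi> x) \<bullet> b))"
    if \<psi>: "\<psi> \<in> Cc_infinity \<Omega>" and b: "b \<in> Basis" for \<psi> b
  proof -
    have "(LINT x|M. u x * (grad \<psi> x \<bullet> b)) = - (LINT x|M. \<psi> x * (G x \<bullet> b))"
      using u(2)[unfolded is_weak_grad_iff[OF u(1)]] \<psi> b by blast
    then show ?thesis
      using Cc_infinity_integration_by_parts[OF \<phi> \<psi>, of b]
      by (simp add: left_diff_distrib right_diff_distrib inner_diff_left L2_integrable_mult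
          Cc_infinity_L2 L2_inner_const grad_L2 G u \<phi> \<psi>)
  qed
  then show ?thesis
    by (simp add: is_weak_grad_iff L2_diff u G \<phi> Cc_infinity_L2 grad_L2)
qed

lemma H01_pair_imp_H01:
  assumes "H01_pair u G"
  shows "u \<in> H01 \<Omega>"
proof -
  obtain \<phi> :: "nat \<Rightarrow> 'a \<Rightarrow> real" where \<phi>: "\<And>n. \<phi> n \<in> Cc_infinity \<Omega>"
    "(\<lambda>n. sq_norm \<Omega> (\<lambda>x. \<phi> n x - u x)) \<longlonglongrightarrow> 0"
    "(\<lambda>n. sq_norm \<Omega> (\<lambda>x. grad (\<phi> n) x - G x)) \<longlonglongrightarrow> 0"
    using that by (rule H01_pairE[OF assms])
  note u = H01_pairD[OF assms]
  note weak = H01_pair_is_weak_grad[OF assms]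
  have "(\<lambda>n. sqrt (sq_norm \<Omega> (\<lambda>x. \<phi> n x - u x) + sq_norm \<Omega> (\<lambda>x. grad (\<phi> n) x - G x))) \<longlonglongrightarrow> sqrt (0 + 0)"
    by (intro tendsto_intros \<phi>)
  moreover have "H1_norm \<Omega> (\<lambda>x. u x - \<phi> n x) =
      sqrt (sq_norm \<Omega> (\<lambda>x. \<phi> n x - u x) + sq_norm \<Omega> (\<lambda>x. grad (\<phi> n) x - G x))" for n
    using H1_norm_eq[OF L2_diff[OF u(1) Cc_infinity_L2[OF \<phi>(1)]] is_weak_grad_diff[OF u(1) weak \<phi>(1)]]
    by (simp add: sq_norm_minus_commute[of \<Omega> u] sq_norm_minus_commute[of \<Omega> G])
  ultimately have lim: "(\<lambda>n. H1_norm \<Omega> (\<lambda>x. u x - \<phi> n x)) \<longlonglongrightarrow> 0"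
    by simp
  have "\<exists>\<psi>\<in>Cc_infinity \<Omega>. H1_norm \<Omega> (\<lambda>x. u x - \<psi> x) < e" if "e > 0" for e
  proof -
    have "\<forall>\<^sub>F n in sequentially. H1_norm \<Omega> (\<lambda>x. u x - \<phi> n x) < e"
      using order_tendstoD(2)[OF lim that] .
    then obtain n where "H1_norm \<Omega> (\<lambda>x. u x - \<phi> n x) < e"
      using eventually_happens'[OF sequentially_bot] by blast
    then show ?thesis using \<phi>(1) by blast
  qed
  then show ?thesis
    using u weak by (auto simp: H01_def H1_def)
qed

lemma H01_imp_H01_pair:
  assumes "u \<in> H01 \<Omega>"
  shows "H01_pair u (weak_grad \<Omega> u)"
proof -
  have u: "u \<in> L2 \<Omega>" "is_weak_grad \<Omega> u (weak_grad \<Omega> u)" "weak_grad \<Omega> u \<in> L2 \<Omega>"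
      and zero: "\<And>x. x \<notin> \<Omega> \<Longrightarrow> u x = 0"
    using assms is_weak_grad_weak_grad weak_grad_AE(2) by (auto simp: H01_def H1_def)
  \<comment> \<open>The tolerance is a square root to match the root in \<open>H1_norm\<close>: the
    sum of the squared errors is then below 1/(n+1).\<close>
  have "\<exists>\<phi>\<in>Cc_infinity \<Omega>. H1_norm \<Omega> (\<lambda>x. u x - \<phi> x) < sqrt (1 / real (Suc n))" for n
    using assms by (simp add: H01_def)
  then obtain \<phi> :: "nat \<Rightarrow> 'a \<Rightarrow> real" where \<phi>: "\<And>n. \<phi> n \<in> Cc_infinity \<Omega>"
      "\<And>n. H1_norm \<Omega> (\<lambda>x. u x - \<phi> n x) < sqrt (1 / real (Suc n))"
    by metis
  have bound: "sq_norm \<Omega> (\<lambda>x. \<phi> n x - u x) + sq_norm \<Omega> (\<lambda>x. grad (\<phi> n) x - weak_grad \<Omega> u x)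
      \<le> inverse (real (Suc n))" for n
    using \<phi>(2)[of n] H1_norm_eq[OF L2_diff[OF u(1) Cc_infinity_L2[OF \<phi>(1)]] is_weak_grad_diff[OF u(1,2) \<phi>(1)]]
    by (simp add: sq_norm_minus_commute[of \<Omega> u] sq_norm_minus_commute[of \<Omega> "weak_grad \<Omega> u"] inverse_eq_divide
        del: of_nat_Suc)
  have null: "F \<longlonglongrightarrow> 0" if "\<And>n. 0 \<le> F n" "\<And>n. F n \<le> inverse (real (Suc n))" for F :: "nat \<Rightarrow> real"
    by (rule real_tendsto_sandwich[OF _ _ tendsto_const LIMSEQ_inverse_real_of_nat])
       (intro always_eventually allI that)+
  have "(\<lambda>n. sq_norm \<Omega> (\<lambda>x. \<phi> n x - u x)) \<longlonglongrightarrow> 0"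
    by (rule null[OF sq_norm_nonneg order_trans[OF _ bound]]) (simp add: sq_norm_nonneg)
  moreover have "(\<lambda>n. sq_norm \<Omega> (\<lambda>x. grad (\<phi> n) x - weak_grad \<Omega> u x)) \<longlonglongrightarrow> 0"
    by (rule null[OF sq_norm_nonneg order_trans[OF _ bound]]) (simp add: sq_norm_nonneg)
  ultimately show ?thesis
    by (intro H01_pairI[of _ _ \<phi>] u zero \<phi>)
qed

lemma L2_tendsto_imp_AE_subseq:
  fixes f :: "nat \<Rightarrow> 'a \<Rightarrow> real"
  assumes f: "\<And>n. f n \<in> L2 \<Omega>" "f' \<in> L2 \<Omega>"
    and lim: "(\<lambda>n. sq_norm \<Omega> (\<lambda>x. f n x - f' x)) \<longlonglongrightarrow> 0"
  obtains r :: "nat \<Rightarrow> nat" where "strict_mono r" "AE x in M. (\<lambda>n. f (r n) x) \<longlonglongrightarrow> f' x"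
proof -
  have "\<exists>r::nat\<Rightarrow>nat. strict_mono r \<and> (AE x in M. (\<lambda>n. (norm (f (r n) x - f' x))\<^sup>2) \<longlonglongrightarrow> 0)"
  proof (rule tendsto_L1_AE_subseq)
    show "integrable M (\<lambda>x. (norm (f n x - f' x))\<^sup>2)" for n
      by (intro L2_integrable L2_diff f)
    show "(\<lambda>n. LINT x|M. norm ((norm (f n x - f' x))\<^sup>2)) \<longlonglongrightarrow> 0"
      using lim by (simp add: sq_norm_def)
  qed
  then obtain r :: "nat \<Rightarrow> nat" where r: "strict_mono r"
      "AE x in M. (\<lambda>n. (norm (f (r n) x - f' x))\<^sup>2) \<longlonglongrightarrow> 0"
    by blast
  from r(2) have "AE x in M. (\<lambda>n. f (r n) x) \<longlonglongrightarrow> f' x"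
  proof eventually_elim
    case (elim x)
    from tendsto_real_sqrt[OF elim] have "(\<lambda>n. norm (f (r n) x - f' x)) \<longlonglongrightarrow> 0"
      by simp
    then show ?case
      using LIM_zero_cancel tendsto_norm_zero_iff by blast
  qed
  with r(1) show thesis by (rule that)
qed

text \<open>Write s for \<open>smooth_pos' e\<close>. Along approximants psi_n, the gradient error
  is s(psi_n) (grad psi_n - G) + (s(psi_n) - s(u)) G. The first term is controlled by |s| \<le> 1,
  the second by dominated convergence with majorant |G|^2 for its square.\<close>

lemma H01_pair_smooth_pos:
  assumes "H01_pair u G" and e: "e > 0"
  shows "H01_pair (\<lambda>x. smooth_pos e (u x)) (\<lambda>x. smooth_pos' e (u x) *\<^sub>R G x)"
proof -
  obtain \<phi> :: "nat \<Rightarrow> 'a \<Rightarrow> real" where \<phi>: "\<And>n. \<phi> n \<in> Cc_infinity \<Omega>"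
    "(\<lambda>n. sq_norm \<Omega> (\<lambda>x. \<phi> n x - u x)) \<longlonglongrightarrow> 0"
    "(\<lambda>n. sq_norm \<Omega> (\<lambda>x. grad (\<phi> n) x - G x)) \<longlonglongrightarrow> 0"
    using that by (rule H01_pairE[OF assms(1)])
  note u = H01_pairD[OF assms(1)]
  \<comment> \<open>Dominated convergence needs pointwise limits inside the continuous function
    \<open>smooth_pos' e\<close>, and L2 convergence supplies them only along a subsequence.\<close>
  obtain r :: "nat \<Rightarrow> nat" where r: "strict_mono r" and AE: "AE x in M. (\<lambda>n. \<phi> (r n) x) \<longlonglongrightarrow> u x"
    using that by (rule L2_tendsto_imp_AE_subseq[OF Cc_infinity_L2[OF \<phi>(1)] u(1) \<phi>(2)])
  define \<psi> where "\<psi> n = \<phi> (r n)" for n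
  have \<psi>: "\<psi> n \<in> Cc_infinity \<Omega>" for n
    by (simp add: \<psi>_def \<phi>(1))
  have lim: "(\<lambda>n. sq_norm \<Omega> (\<lambda>x. \<psi> n x - u x)) \<longlonglongrightarrow> 0"
      "(\<lambda>n. sq_norm \<Omega> (\<lambda>x. grad (\<psi> n) x - G x)) \<longlonglongrightarrow> 0"
    using LIMSEQ_subseq_LIMSEQ[OF \<phi>(2) r] LIMSEQ_subseq_LIMSEQ[OF \<phi>(3) r]
    by (simp_all add: \<psi>_def comp_def)
  have cont_p: "smooth_pos e \<in> borel_measurable borel"
    using DERIV_smooth_pos DERIV_isCont
    by (intro borel_measurable_continuous_onI continuous_at_imp_continuous_on) blast
  have cont_s: "smooth_pos' e \<in> borel_measurable borel"
    by (intro borel_measurable_continuous_onI continuous_smooth_pos')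
  have s_bound: "\<bar>smooth_pos' e t\<bar> \<le> 1" for t
    using smooth_pos'_bounds[OF e, of t] by simp
  have p_L2: "(\<lambda>x. smooth_pos e (w x)) \<in> L2 \<Omega>" if "w \<in> L2 \<Omega>" for w
  proof (rule L2I_bound[OF measurable_compose[OF L2_measurable[OF that] cont_p] L2_integrable[OF that]])
    show "(norm (smooth_pos e (w x)))\<^sup>2 \<le> (norm (w x))\<^sup>2" for x
      using abs_smooth_pos_diff_le[OF e, of "w x" 0]
      by (intro power_mono) (simp_all add: smooth_pos_0 e)
  qed
  have s_meas: "(\<lambda>x. smooth_pos' e (w x)) \<in> borel_measurable M" if "w \<in> L2 \<Omega>" for w
    using measurable_compose[OF L2_measurable[OF that] cont_s] .
  have s_L2: "(\<lambda>x. smooth_pos' e (w x) *\<^sub>R H x) \<in> L2 \<Omega>" if "w \<in> L2 \<Omega>" "H \<in> L2 \<Omega>" for w H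
    by (rule L2_bounded_mult[OF s_meas[OF that(1)] s_bound that(2)])
  have lim_p: "(\<lambda>n. sq_norm \<Omega> (\<lambda>x. smooth_pos e (\<psi> n x) - smooth_pos e (u x))) \<longlonglongrightarrow> 0"
  proof (rule real_tendsto_sandwich[OF _ _ tendsto_const lim(1)])
    have "sq_norm \<Omega> (\<lambda>x. smooth_pos e (\<psi> n x) - smooth_pos e (u x)) \<le> sq_norm \<Omega> (\<lambda>x. \<psi> n x - u x)" for n
      using abs_smooth_pos_diff_le[OF e]
      by (intro sq_norm_mono L2_diff p_L2 u Cc_infinity_L2[OF \<psi>]) simp
    then show "\<forall>\<^sub>F n in sequentially. sq_norm \<Omega> (\<lambda>x. smooth_pos e (\<psi> n x) - smooth_pos e (u x))
        \<le> sq_norm \<Omega> (\<lambda>x. \<psi> n x - u x)"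
      by (intro always_eventually allI)
  qed (simp add: sq_norm_nonneg)
  define R where "R n x = (smooth_pos' e (\<psi> n x) - smooth_pos' e (u x)) *\<^sub>R G x" for n x
  have R_L2: "R n \<in> L2 \<Omega>" for n
    using L2_diff[OF s_L2[OF Cc_infinity_L2[OF \<psi>] u(2)] s_L2[OF u(1,2)], of n]
    by (simp add: R_def[abs_def] scaleR_diff_left)
  have lim_R: "(\<lambda>n. sq_norm \<Omega> (R n)) \<longlonglongrightarrow> 0"
  proof -
    have "(\<lambda>n. LINT x|M. (norm (R n x))\<^sup>2) \<longlonglongrightarrow> (LINT x|M. 0)"
    proof (rule integral_dominated_convergence[where w = "\<lambda>x. (norm (G x))\<^sup>2"])
      show "integrable M (\<lambda>x. (norm (G x))\<^sup>2)"
        by (rule L2_integrable[OF u(2)])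
      show "(\<lambda>x. (norm (R n x))\<^sup>2) \<in> borel_measurable M" for n
        by (rule borel_measurable_integrable[OF L2_integrable[OF R_L2]])
      show "AE x in M. norm ((norm (R n x))\<^sup>2) \<le> (norm (G x))\<^sup>2" for n
      proof (rule AE_I2)
        fix x
        have "\<bar>smooth_pos' e (\<psi> n x) - smooth_pos' e (u x)\<bar> \<le> 1"
          using smooth_pos'_bounds[OF e, of "\<psi> n x"] smooth_pos'_bounds[OF e, of "u x"] by linarith
        then have "norm (R n x) \<le> norm (G x)"
          by (simp add: R_def mult_left_le_one_le)
        then have "(norm (R n x))\<^sup>2 \<le> (norm (G x))\<^sup>2"
          by (intro power_mono) simp_all
        then show "norm ((norm (R n x))\<^sup>2) \<le> (norm (G x))\<^sup>2"
          by simp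
      qed
      show "AE x in M. (\<lambda>n. (norm (R n x))\<^sup>2) \<longlonglongrightarrow> 0"
        using AE
      proof eventually_elim
        case (elim x)
        have "isCont (smooth_pos' e) (u x)"
          using continuous_smooth_pos' by (simp add: continuous_on_eq_continuous_at)
        then have "(\<lambda>n. smooth_pos' e (\<psi> n x)) \<longlonglongrightarrow> smooth_pos' e (u x)"
          unfolding \<psi>_def using elim by (rule isCont_tendsto_compose)
        then have "(\<lambda>n. (norm (R n x))\<^sup>2) \<longlonglongrightarrow> (norm ((smooth_pos' e (u x) - smooth_pos' e (u x)) *\<^sub>R G x))\<^sup>2"
          unfolding R_def by (intro tendsto_intros)
        then show ?case by simp
      qed
    qed simp
    then show ?thesis by (simp add: sq_norm_def)
  qed
  have lim_s: "(\<lambda>n. sq_norm \<Omega> (\<lambda>x. grad (\<lambda>x. smooth_pos e (\<psi> n x)) x - smooth_pos' e (u x) *\<^sub>R G x)) \<longlonglongrightarrow> 0"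
  proof (rule real_tendsto_sandwich[OF _ _ tendsto_const])
    let ?h = "\<lambda>n. 2 * sq_norm \<Omega> (\<lambda>x. grad (\<psi> n) x - G x) + 2 * sq_norm \<Omega> (R n)"
    have "sq_norm \<Omega> (\<lambda>x. grad (\<lambda>x. smooth_pos e (\<psi> n x)) x - smooth_pos' e (u x) *\<^sub>R G x) \<le> ?h n" for n
    proof -
      let ?D = "\<lambda>x. grad (\<psi> n) x - G x"
      have D: "?D \<in> L2 \<Omega>"
        by (intro L2_diff grad_L2[OF \<psi>] u)
      have sD: "(\<lambda>x. smooth_pos' e (\<psi> n x) *\<^sub>R ?D x) \<in> L2 \<Omega>"
        by (rule s_L2[OF Cc_infinity_L2[OF \<psi>] D])
      have "grad (\<lambda>x. smooth_pos e (\<psi> n x)) x - smooth_pos' e (u x) *\<^sub>R G x =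
          smooth_pos' e (\<psi> n x) *\<^sub>R ?D x + R n x" for x
        by (simp add: grad_smooth_pos[OF \<psi>] R_def scaleR_diff_left scaleR_diff_right)
      then have "sq_norm \<Omega> (\<lambda>x. grad (\<lambda>x. smooth_pos e (\<psi> n x)) x - smooth_pos' e (u x) *\<^sub>R G x)
          \<le> 2 * sq_norm \<Omega> (\<lambda>x. smooth_pos' e (\<psi> n x) *\<^sub>R ?D x) + 2 * sq_norm \<Omega> (R n)"
        using sq_norm_add_le[OF sD R_L2[of n]] by (simp only:)
      moreover have "sq_norm \<Omega> (\<lambda>x. smooth_pos' e (\<psi> n x) *\<^sub>R ?D x) \<le> sq_norm \<Omega> ?D"
        using s_bound by (intro sq_norm_mono[OF sD D]) (simp add: mult_left_le_one_le)
      ultimately show ?thesis by linarith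
    qed
    then show "\<forall>\<^sub>F n in sequentially.
        sq_norm \<Omega> (\<lambda>x. grad (\<lambda>x. smooth_pos e (\<psi> n x)) x - smooth_pos' e (u x) *\<^sub>R G x) \<le> ?h n"
      by (intro always_eventually allI)
    have "?h \<longlonglongrightarrow> 2 * 0 + 2 * 0"
      by (intro tendsto_add tendsto_mult_left lim lim_R)
    then show "?h \<longlonglongrightarrow> 0" by simp
  qed (simp add: sq_norm_nonneg)
  show ?thesis
  proof (rule H01_pairI[where \<phi> = "\<lambda>n x. smooth_pos e (\<psi> n x)"])
    show "smooth_pos e (u x) = 0" if "x \<notin> \<Omega>" for x
      using u(3)[OF that] e by (simp add: smooth_pos_0)
  qed (rule p_L2[OF u(1)] s_L2[OF u(1,2)] Cc_infinity_smooth_pos[OF \<psi> e] lim_p lim_s)+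
qed

section \<open>The Poincare inequality with the constant given by \<open>k_star\<close>\<close>

lemma Poincare_Cc_infinity:
  assumes "\<phi> \<in> Cc_infinity \<Omega>"
  shows "(k_star \<Omega>)\<^sup>2 * sq_norm \<Omega> \<phi> \<le> sq_norm \<Omega> (grad \<phi>)"
proof (cases "sq_norm \<Omega> \<phi> = 0")
  case False
  define R where "R \<phi> = (LINT x|M. (norm (grad \<phi> x))\<^sup>2) / (LINT x|M. (\<phi> x)\<^sup>2)" for \<phi> :: "'a \<Rightarrow> real"
  define A where "A = {\<phi> \<in> Cc_infinity \<Omega>. \<exists>x. \<phi> x \<noteq> 0}"
  have "\<exists>x. \<phi> x \<noteq> 0"
  proof (rule ccontr)
    assume "\<nexists>x. \<phi> x \<noteq> 0"
    then have "sq_norm \<Omega> \<phi> = 0"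
      by (simp add: sq_norm_def)
    with False show False ..
  qed
  then have "\<phi> \<in> A"
    using assms by (simp add: A_def)
  \<comment> \<open>Nonnegativity serves twice: it bounds the set below, so that the real infimum is
    a lower bound, and it makes the infimum nonnegative, so that squaring undoes the root in
    \<open>k_star\<close>.\<close>
  have nonneg: "0 \<le> R \<phi>" for \<phi>
    by (simp add: R_def)
  then have "0 \<le> (INF \<phi>\<in>A. R \<phi>)"
    using \<open>\<phi> \<in> A\<close> by (intro cINF_greatest) auto
  then have "(k_star \<Omega>)\<^sup>2 = (INF \<phi>\<in>A. R \<phi>)"
    by (simp add: k_star_def A_def R_def)
  also have "\<dots> \<le> R \<phi>"
    using nonneg \<open>\<phi> \<in> A\<close> by (intro cINF_lower bdd_belowI2[where m = 0])
  also have "R \<phi> = sq_norm \<Omega> (grad \<phi>) / sq_norm \<Omega> \<phi>"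
    by (simp add: R_def sq_norm_def)
  finally show ?thesis
    using False sq_norm_nonneg[of \<Omega> \<phi>] by (simp add: pos_le_divide_eq)
qed (simp add: sq_norm_nonneg)

lemma Poincare:
  assumes "H01_pair u G"
  shows "(k_star \<Omega>)\<^sup>2 * sq_norm \<Omega> u \<le> sq_norm \<Omega> G"
proof -
  obtain \<phi> :: "nat \<Rightarrow> 'a \<Rightarrow> real" where \<phi>: "\<And>n. \<phi> n \<in> Cc_infinity \<Omega>"
    "(\<lambda>n. sq_norm \<Omega> (\<lambda>x. \<phi> n x - u x)) \<longlonglongrightarrow> 0"
    "(\<lambda>n. sq_norm \<Omega> (\<lambda>x. grad (\<phi> n) x - G x)) \<longlonglongrightarrow> 0"
    using that by (rule H01_pairE[OF assms])
  note u = H01_pairD[OF assms]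
  show ?thesis
  proof (rule LIMSEQ_le)
    show "(\<lambda>n. (k_star \<Omega>)\<^sup>2 * sq_norm \<Omega> (\<phi> n)) \<longlonglongrightarrow> (k_star \<Omega>)\<^sup>2 * sq_norm \<Omega> u"
      by (rule tendsto_mult_left[OF sq_norm_tendsto[OF Cc_infinity_L2[OF \<phi>(1)] u(1) \<phi>(2)]])
    show "(\<lambda>n. sq_norm \<Omega> (grad (\<phi> n))) \<longlonglongrightarrow> sq_norm \<Omega> G"
      by (rule sq_norm_tendsto[OF grad_L2[OF \<phi>(1)] u(2) \<phi>(3)])
  qed (use Poincare_Cc_infinity[OF \<phi>(1)] in blast)
qed

section \<open>The energy and its first variation\<close>

lemma energy_eq:
  assumes "H01_pair u G" and f: "f \<in> L2 \<Omega>"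
  shows "energy \<Omega> f k u = sq_norm \<Omega> G - k\<^sup>2 * sq_norm \<Omega> u - 2 * (LINT x|M. f x * u x)"
proof -
  note u = H01_pairD[OF assms(1)]
  note wg = weak_grad_AE[OF u(1) H01_pair_is_weak_grad[OF assms(1)]]
  have "energy \<Omega> f k u = (LINT x|M. (norm (weak_grad \<Omega> u x))\<^sup>2 - k\<^sup>2 * (norm (u x))\<^sup>2 - 2 * (f x * u x))"
    by (simp add: energy_def mult.assoc)
  also have "\<dots> = sq_norm \<Omega> (weak_grad \<Omega> u) - k\<^sup>2 * sq_norm \<Omega> u - 2 * (LINT x|M. f x * u x)"
    unfolding sq_norm_def using L2_integrable[OF wg(2)] L2_integrable[OF u(1)] L2_integrable_mult[OF f u(1)]
    by simp
  finally show ?thesis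
    using sq_norm_cong_AE[OF wg(2) u(2) wg(1)] by simp
qed

text \<open>Half the directional derivative of the energy at \<open>u\<close> in direction
  \<open>h\<close>, where \<open>G\<close> and \<open>H\<close> stand for the gradients of
  \<open>u\<close> and \<open>h\<close>.\<close>

definition energy_form :: "('a \<Rightarrow> real) \<Rightarrow> real \<Rightarrow> ('a \<Rightarrow> real) \<Rightarrow> ('a \<Rightarrow> 'a) \<Rightarrow> ('a \<Rightarrow> real) \<Rightarrow> ('a \<Rightarrow> 'a) \<Rightarrow> real" where
  "energy_form f k u G h H =
     (LINT x|M. G x \<bullet> H x) - k\<^sup>2 * (LINT x|M. u x * h x) - (LINT x|M. f x * h x)"

lemma energy_add:
  assumes "H01_pair u G" "H01_pair h H" and f: "f \<in> L2 \<Omega>"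
  shows "energy \<Omega> f k (\<lambda>x. u x + t * h x) =
    energy \<Omega> f k u + 2 * t * energy_form f k u G h H + t\<^sup>2 * (sq_norm \<Omega> H - k\<^sup>2 * sq_norm \<Omega> h)"
proof -
  note u = H01_pairD[OF assms(1)] and h = H01_pairD[OF assms(2)]
  have 1: "sq_norm \<Omega> (\<lambda>x. G x + t *\<^sub>R H x) =
      sq_norm \<Omega> G + 2 * t * (LINT x|M. G x \<bullet> H x) + t\<^sup>2 * sq_norm \<Omega> H"
    by (rule sq_norm_linear_combination[OF u(2) h(2)])
  have 2: "sq_norm \<Omega> (\<lambda>x. u x + t * h x) =
      sq_norm \<Omega> u + 2 * t * (LINT x|M. u x * h x) + t\<^sup>2 * sq_norm \<Omega> h"
    using sq_norm_linear_combination[OF u(1) h(1), of t] by simp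
  have "f x * (u x + t * h x) = f x * u x + t * (f x * h x)" for x
    by (simp add: algebra_simps)
  then have 3: "(LINT x|M. f x * (u x + t * h x)) = (LINT x|M. f x * u x) + t * (LINT x|M. f x * h x)"
    using L2_integrable_mult[OF f u(1)] L2_integrable_mult[OF f h(1)] by simp
  show ?thesis
    unfolding energy_eq[OF H01_pair_linear[OF assms(1,2)] f] energy_eq[OF assms(1) f] 1 2 3 energy_form_def
    by (simp add: algebra_simps)
qed

text \<open>A one-sided derivative at a minimum is nonnegative. Only \<open>t\<close> in (0,1] is
  assumed, because the competitors used later are admissible in one direction and for small steps
  only.\<close>

lemma energy_form_nonneg:
  assumes "H01_pair u G" "H01_pair h H" and f: "f \<in> L2 \<Omega>"
    and min: "\<And>t. 0 < t \<Longrightarrow> t \<le> 1 \<Longrightarrow> energy \<Omega> f k u \<le> energy \<Omega> f k (\<lambda>x. u x + t * h x)"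
  shows "0 \<le> energy_form f k u G h H"
proof (rule ccontr)
  define B C where "B = energy_form f k u G h H" and "C = sq_norm \<Omega> H - k\<^sup>2 * sq_norm \<Omega> h"
  assume "\<not> 0 \<le> energy_form f k u G h H"
  then have B: "B < 0" by (simp add: B_def)
  \<comment> \<open>The choice gives t C \<le> -B, hence 2 B + t C \<le> B < 0; the added 1 keeps
    the denominator positive.\<close>
  define t where "t = min 1 (- B / (\<bar>C\<bar> + 1))"
  have t: "0 < t" "t \<le> 1" "t \<le> - B / (\<bar>C\<bar> + 1)"
    using B by (auto simp: t_def divide_neg_pos)
  have "t * (\<bar>C\<bar> + 1) \<le> - B"
    by (rule pos_le_divide_eq[THEN iffD1, OF _ t(3)]) simp
  moreover have "t * C \<le> t * (\<bar>C\<bar> + 1)"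
    using t by (intro mult_left_mono) auto
  ultimately have "2 * B + t * C < 0"
    using B by linarith
  then have "t * (2 * B + t * C) < 0"
    using t by (intro mult_pos_neg)
  moreover have "0 \<le> 2 * t * B + t\<^sup>2 * C"
    using min[OF t(1,2)] energy_add[OF assms(1,2) f, of k t] by (simp add: B_def C_def)
  ultimately show False
    by (simp add: power2_eq_square algebra_simps)
qed

end

subsection \<open>Comparison and strict positivity\<close>

lemma L2_max_0:
  fixes f :: "'a::euclidean_space \<Rightarrow> real"
  assumes "f \<in> L2 \<Omega>"
  shows "(\<lambda>x. max 0 (f x)) \<in> L2 \<Omega>"
proof (rule L2I_bound[OF _ L2_integrable[OF assms]])
  show "(\<lambda>x. max 0 (f x)) \<in> borel_measurable (lebesgue_on \<Omega>)"
    using L2_measurable[OF assms] by measurable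
qed (auto simp: max_def)

context bounded_open
begin

lemma energy_form_uminus: "energy_form f k u G (\<lambda>x. - h x) (\<lambda>x. - H x) = - energy_form f k u G h H"
  by (simp add: energy_form_def)

text \<open>The Poincare inequality is applied to the truncations and only their L2 limit is taken.
  The positive part of \<open>w\<close> therefore never has to be shown to be a Sobolev
  function.\<close>

lemma sq_norm_pos_part_le:
  assumes w: "H01_pair w W"
    and le: "\<And>e. e > 0 \<Longrightarrow>
      (LINT x|M. W x \<bullet> (smooth_pos' e (w x) *\<^sub>R W x)) \<le> k\<^sup>2 * (LINT x|M. w x * smooth_pos e (w x))"
  shows "(k_star \<Omega>)\<^sup>2 * sq_norm \<Omega> (\<lambda>x. max 0 (w x)) \<le> k\<^sup>2 * sq_norm \<Omega> (\<lambda>x. max 0 (w x))"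
proof -
  define e where "e n = inverse (real (Suc n))" for n
  have e: "e n > 0" for n
    by (simp add: e_def)
  note L2 = H01_pairD[OF w]
  define p where "p n x = smooth_pos (e n) (w x)" for n x
  have p: "H01_pair (p n) (\<lambda>x. smooth_pos' (e n) (w x) *\<^sub>R W x)" for n
    unfolding p_def by (rule H01_pair_smooth_pos[OF w e])
  note p_L2 = H01_pairD[OF p]
  have bound: "(k_star \<Omega>)\<^sup>2 * sq_norm \<Omega> (p n) \<le> k\<^sup>2 * (LINT x|M. p n x * w x)" for n
  proof -
    have "(k_star \<Omega>)\<^sup>2 * sq_norm \<Omega> (p n) \<le> sq_norm \<Omega> (\<lambda>x. smooth_pos' (e n) (w x) *\<^sub>R W x)"
      by (rule Poincare[OF p])
    also have "\<dots> \<le> (LINT x|M. W x \<bullet> (smooth_pos' (e n) (w x) *\<^sub>R W x))"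
      unfolding sq_norm_def
    proof (rule integral_mono[OF L2_integrable[OF p_L2(2)] L2_integrable_inner[OF L2(2) p_L2(2)]])
      fix x
      let ?s = "smooth_pos' (e n) (w x)"
      have "?s * ?s \<le> ?s"
        using smooth_pos'_bounds[OF e[of n], of "w x"] by (simp add: mult_left_le)
      then have "?s * ?s * (norm (W x))\<^sup>2 \<le> ?s * (norm (W x))\<^sup>2"
        by (intro mult_right_mono) simp_all
      then show "(norm (?s *\<^sub>R W x))\<^sup>2 \<le> W x \<bullet> (?s *\<^sub>R W x)"
        by (simp add: power_mult_distrib power2_eq_square[of ?s] power2_norm_eq_inner)
    qed
    also have "\<dots> \<le> k\<^sup>2 * (LINT x|M. w x * smooth_pos (e n) (w x))"
      by (rule le[OF e])
    finally show ?thesis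
      by (simp add: p_def mult.commute)
  qed
  have pos_L2: "(\<lambda>x. max 0 (w x)) \<in> L2 \<Omega>"
    by (rule L2_max_0[OF L2(1)])
  have null: "(\<lambda>n. sq_norm \<Omega> (\<lambda>x. p n x - max 0 (w x))) \<longlonglongrightarrow> 0"
  proof (rule real_tendsto_sandwich[OF _ _ tendsto_const])
    \<comment> \<open>The uniform error \<open>e n\<close> turns into an L2 error because the domain
      has finite measure.\<close>
    have "sq_norm \<Omega> (\<lambda>x. p n x - max 0 (w x)) \<le> sq_norm \<Omega> (\<lambda>x. e n)" for n
    proof (rule sq_norm_mono)
      show "(\<lambda>x. p n x - max 0 (w x)) \<in> L2 \<Omega>"
        by (rule L2_diff[OF p_L2(1) pos_L2])
      show "(\<lambda>x. e n) \<in> L2 \<Omega>"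
        by (rule L2_bounded[of _ "\<bar>e n\<bar>"]) simp_all
      show "norm (p n x - max 0 (w x)) \<le> norm (e n)" for x
        using smooth_pos_le[OF e[of n], of "w x"] smooth_pos_ge[OF e[of n], of "w x"] e[of n]
        by (simp add: p_def abs_le_iff)
    qed
    then show "\<forall>\<^sub>F n in sequentially. sq_norm \<Omega> (\<lambda>x. p n x - max 0 (w x)) \<le> (e n)\<^sup>2 * measure M (space M)"
      by (intro always_eventually allI) (simp add: sq_norm_def mult.commute)
    have "(\<lambda>n. (e n)\<^sup>2 * measure M (space M)) \<longlonglongrightarrow> 0\<^sup>2 * measure M (space M)"
      unfolding e_def by (intro tendsto_mult_right tendsto_power LIMSEQ_inverse_real_of_nat)
    then show "(\<lambda>n. (e n)\<^sup>2 * measure M (space M)) \<longlonglongrightarrow> 0"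
      by simp
  qed (simp add: sq_norm_nonneg)
  have "(LINT x|M. max 0 (w x) \<bullet> w x) = sq_norm \<Omega> (\<lambda>x. max 0 (w x))"
    unfolding sq_norm_def
    by (intro Bochner_Integration.integral_cong) (auto simp: max_def power2_eq_square)
  moreover have "(\<lambda>n. LINT x|M. p n x \<bullet> w x) \<longlonglongrightarrow> (LINT x|M. max 0 (w x) \<bullet> w x)"
    by (rule L2_inner_tendsto[OF p_L2(1) pos_L2 L2(1) null])
  ultimately have lim: "(\<lambda>n. LINT x|M. p n x * w x) \<longlonglongrightarrow> sq_norm \<Omega> (\<lambda>x. max 0 (w x))"
    by simp
  show ?thesis
    by (rule LIMSEQ_le[OF tendsto_mult_left[OF sq_norm_tendsto[OF p_L2(1) pos_L2 null]] tendsto_mult_left[OF lim]])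
       (use bound in blast)
qed

text \<open>
  Testing minimality of \<open>u\<close> and \<open>v\<close> with a smooth truncation of \<open>(u - v)\<^sup>+\<close>, rather than with the
  lattice operations, only requires the chain rule for smooth functions in the Sobolev space.
\<close>

lemma comparison:
  assumes u: "H01_pair u G" and v: "H01_pair v H" and f: "f \<in> L2 \<Omega>"
    and k: "0 \<le> k" "k < k_star \<Omega>"
    and min_u: "\<And>e t. 0 < e \<Longrightarrow> 0 < t \<Longrightarrow> t \<le> 1 \<Longrightarrow>
      energy \<Omega> f k u \<le> energy \<Omega> f k (\<lambda>x. u x + t * - smooth_pos e (u x - v x))"
    and min_v: "\<And>e t. 0 < e \<Longrightarrow> 0 < t \<Longrightarrow> t \<le> 1 \<Longrightarrow>
      energy \<Omega> f k v \<le> energy \<Omega> f k (\<lambda>x. v x + t * smooth_pos e (u x - v x))"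
  shows "AE x in M. u x \<le> v x"
proof -
  have w: "H01_pair (\<lambda>x. u x - v x) (\<lambda>x. G x - H x)"
    using H01_pair_linear[OF u v, of "- 1"] by simp
  let ?S = "sq_norm \<Omega> (\<lambda>x. max 0 (u x - v x))"
  have "(k_star \<Omega>)\<^sup>2 * ?S \<le> k\<^sup>2 * ?S"
  proof (rule sq_norm_pos_part_le[OF w])
    fix e :: real assume e: "e > 0"
    let ?p = "\<lambda>x. smooth_pos e (u x - v x)"
    let ?P = "\<lambda>x. smooth_pos' e (u x - v x) *\<^sub>R (G x - H x)"
    have p: "H01_pair ?p ?P"
      by (rule H01_pair_smooth_pos[OF w e])
    \<comment> \<open>The negated pair is produced as 0 + (-1) p, so the gradient of the zero test
      function has to be simplified away.\<close>
    have "grad (\<lambda>x. 0) x = 0" for x :: 'a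
      by (rule grad_eqI) simp
    then have mp: "H01_pair (\<lambda>x. - ?p x) (\<lambda>x. - ?P x)"
      using H01_pair_linear[OF H01_pair_Cc_infinity[OF Cc_infinity_zero] p, of "- 1"]
      by simp
    have "0 \<le> energy_form f k u G (\<lambda>x. - ?p x) (\<lambda>x. - ?P x)"
      by (rule energy_form_nonneg[OF u mp f min_u[OF e]])
    moreover have "0 \<le> energy_form f k v H ?p ?P"
      by (rule energy_form_nonneg[OF v p f min_v[OF e]])
    moreover have "(LINT x|M. (G x - H x) \<bullet> ?P x) = (LINT x|M. G x \<bullet> ?P x) - (LINT x|M. H x \<bullet> ?P x)"
      using L2_integrable_inner[OF H01_pairD(2)[OF u] H01_pairD(2)[OF p]]
        L2_integrable_inner[OF H01_pairD(2)[OF v] H01_pairD(2)[OF p]]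
      by (simp only: inner_diff_left[of "G _" "H _"] Bochner_Integration.integral_diff)
    moreover have "(LINT x|M. (u x - v x) * ?p x) = (LINT x|M. u x * ?p x) - (LINT x|M. v x * ?p x)"
      using L2_integrable_mult[OF H01_pairD(1)[OF u] H01_pairD(1)[OF p]]
        L2_integrable_mult[OF H01_pairD(1)[OF v] H01_pairD(1)[OF p]]
      by (simp only: left_diff_distrib[of "u _" "v _"] Bochner_Integration.integral_diff)
    \<comment> \<open>Adding the two inequalities cancels the terms with \<open>f\<close> and leaves
      a quadratic statement about the difference alone.\<close>
    ultimately show "(LINT x|M. (G x - H x) \<bullet> ?P x) \<le> k\<^sup>2 * (LINT x|M. (u x - v x) * ?p x)"
      unfolding energy_form_uminus by (simp add: energy_form_def right_diff_distrib)
  qed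
  moreover have "k\<^sup>2 < (k_star \<Omega>)\<^sup>2"
    using k by (intro power_strict_mono) simp_all
  ultimately have "?S = 0"
    using sq_norm_nonneg[of \<Omega> "\<lambda>x. max 0 (u x - v x)"] mult_strict_right_mono[of "k\<^sup>2" "(k_star \<Omega>)\<^sup>2" ?S]
    by (cases "?S = 0") linarith+
  moreover have "(\<lambda>x. max 0 (u x - v x)) \<in> L2 \<Omega>"
    by (rule L2_max_0[OF H01_pairD(1)[OF w]])
  ultimately have "AE x in M. max 0 (u x - v x) = 0"
    using sq_norm_eq_0 by blast
  then show ?thesis
    by eventually_elim (simp add: max_def split: if_splits)
qed

lemma L_infinity_diff_const_L2:
  assumes "\<mu> \<in> L_infinity"
  shows "(\<lambda>x. \<mu> x - c) \<in> L2 \<Omega>"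
proof -
  obtain C where C: "AE x in lebesgue. \<bar>\<mu> x\<bar> \<le> C" and meas: "\<mu> \<in> borel_measurable lebesgue"
    using assms by (auto simp: L_infinity_def)
  have [measurable]: "\<mu> \<in> borel_measurable M"
    using meas by (rule measurable_restrict_space1)
  have "AE x in M. \<bar>\<mu> x\<bar> \<le> C"
    unfolding AE_M_iff using C by eventually_elim simp
  then have "AE x in M. norm ((norm (\<mu> x - c))\<^sup>2) \<le> (C + \<bar>c\<bar>)\<^sup>2"
  proof eventually_elim
    case (elim x)
    then have "norm (\<mu> x - c) \<le> C + \<bar>c\<bar>" by simp
    then have "(norm (\<mu> x - c))\<^sup>2 \<le> (C + \<bar>c\<bar>)\<^sup>2"
      by (rule power_mono) simp
    then show ?case by simp
  qed
  then have "integrable M (\<lambda>x. (norm (\<mu> x - c))\<^sup>2)"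
    by (intro integrable_const_bound) simp_all
  then show ?thesis
    by (simp add: L2_def)
qed

text \<open>
  Moving both derivatives onto the test function shows that \<open>\<integral> \<nabla>u \<cdot> \<nabla>\<phi>\<close> vanishes when \<open>u\<close> does on
  the support of \<open>\<phi>\<close>; no locality of weak gradients is needed.
\<close>

lemma energy_form_vanishing:
  assumes u: "H01_pair u G" and V: "open V" "V \<subseteq> \<Omega>" "AE x in M. x \<in> V \<longrightarrow> u x = 0"
    and \<phi>: "\<phi> \<in> Cc_infinity V"
  shows "energy_form f k u G \<phi> (grad \<phi>) = - (LINT x|M. f x * \<phi> x)"
proof -
  obtain K where K: "K \<subseteq> V" "\<And>x. x \<notin> K \<Longrightarrow> \<phi> x = 0"
    by (rule Cc_infinityE[OF \<phi>]) (rule that)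
  have \<phi>\<Omega>: "\<phi> \<in> Cc_infinity \<Omega>"
    using Cc_infinity_mono[OF V(2) \<phi>] .
  have vanish: "(LINT x|M. u x * g x) = 0" if "\<And>x. x \<notin> V \<Longrightarrow> g x = 0" for g :: "'a \<Rightarrow> real"
  proof (rule integral_eq_zero_AE)
    show "AE x in M. u x * g x = 0"
      using V(3) by eventually_elim (use that in auto)
  qed
  \<comment> \<open>Testing with the partial derivative of \<open>\<phi>\<close> along
    \<open>b\<close>, again in direction \<open>b\<close>, leaves \<open>u\<close> against a pure
    second derivative supported in \<open>V\<close>.\<close>
  have "(LINT x|M. (G x \<bullet> b) * (grad \<phi> x \<bullet> b)) = 0" if b: "b \<in> Basis" for b
  proof -
    have \<psi>: "(\<lambda>x. grad \<phi> x \<bullet> b) \<in> Cc_infinity V"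
      by (rule Cc_infinity_partial[OF \<phi> b])
    obtain L where L: "L \<subseteq> V" "\<And>x. x \<notin> L \<Longrightarrow> grad (\<lambda>x. grad \<phi> x \<bullet> b) x = 0"
      by (rule Cc_infinityE[OF \<psi>]) (rule that)
    have "(LINT x|M. u x * (grad (\<lambda>x. grad \<phi> x \<bullet> b) x \<bullet> b)) = 0"
    proof (rule vanish)
      fix x assume "x \<notin> V"
      then have "x \<notin> L" using L(1) by blast
      from L(2)[OF this] show "grad (\<lambda>x. grad \<phi> x \<bullet> b) x \<bullet> b = 0" by simp
    qed
    then show ?thesis
      using H01_pair_weak[OF u Cc_infinity_mono[OF V(2) \<psi>], of b] by (simp add: mult.commute)
  qed
  moreover have "(LINT x|M. G x \<bullet> grad \<phi> x) = (\<Sum>b\<in>Basis. LINT x|M. (G x \<bullet> b) * (grad \<phi> x \<bullet> b))"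
    unfolding euclidean_inner[of "G _" "grad \<phi> _"]
    by (intro Bochner_Integration.integral_sum L2_integrable_mult L2_inner_const grad_L2 \<phi>\<Omega> H01_pairD[OF u])
  moreover have "(LINT x|M. u x * \<phi> x) = 0"
  proof (rule vanish)
    fix x assume "x \<notin> V"
    then have "x \<notin> K" using K(1) by blast
    then show "\<phi> x = 0" by (rule K(2))
  qed
  ultimately show ?thesis
    by (simp add: energy_form_def)
qed

end

section \<open>Competitors that alter a single component\<close>

lemma total_energy_update:
  assumes "j \<in> {1..m}"
  shows "total_energy m \<Omega> f \<kappa> (u(j := w)) =
    total_energy m \<Omega> f \<kappa> u - energy \<Omega> (f j) (\<kappa> j) (u j) + energy \<Omega> (f j) (\<kappa> j) w"
proof -
  define I where "I = {1..m} - {j}"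
  have split: "(\<Sum>i=1..m. E i) = E j + (\<Sum>i\<in>I. E i)" for E :: "nat \<Rightarrow> real"
    unfolding I_def by (rule sum.remove[OF finite_atLeastAtMost assms])
  have "(\<Sum>i\<in>I. energy \<Omega> (f i) (\<kappa> i) ((u(j := w)) i)) = (\<Sum>i\<in>I. energy \<Omega> (f i) (\<kappa> i) (u i))"
    by (rule sum.cong) (simp_all add: I_def)
  then show ?thesis
    unfolding total_energy_def split by simp
qed

text \<open>Only one summand of the total energy changes, so minimality of the tuple compares
  \<open>u j\<close> with \<open>w\<close> alone. It is enough that \<open>w\<close> be segregated
  from the other components, which are already segregated among themselves.\<close>

lemma segregated_minimizer_energy_le:
  assumes min: "is_arg_min (total_energy m \<Omega> f \<kappa>) (\<lambda>w. w \<in> S_tuples m \<Omega>) u"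
    and j: "j \<in> {1..m}" and w: "w \<in> K_cone \<Omega>"
    and seg: "\<And>l. l \<in> {1..m} \<Longrightarrow> l \<noteq> j \<Longrightarrow> AE x in lebesgue_on \<Omega>. w x * u l x = 0"
  shows "energy \<Omega> (f j) (\<kappa> j) (u j) \<le> energy \<Omega> (f j) (\<kappa> j) w"
proof -
  let ?u = "u(j := w)"
  have u: "u \<in> S_tuples m \<Omega>" and no_less: "\<not> (y \<in> S_tuples m \<Omega> \<and> total_energy m \<Omega> f \<kappa> y < total_energy m \<Omega> f \<kappa> u)" for y
    using min[unfolded is_arg_min_def] by simp_all
  have "AE x in lebesgue_on \<Omega>. ?u i x * ?u l x = 0"
    if il: "i \<in> {1..m}" "l \<in> {1..m}" "i \<noteq> l" for i l
  proof -
    consider "i = j" "l \<noteq> j" | "i \<noteq> j" "l = j" | "i \<noteq> j" "l \<noteq> j"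
      using il(3) by blast
    then show ?thesis
    proof cases
      case 1
      then show ?thesis using seg[OF il(2)] by simp
    next
      case 2
      then show ?thesis using seg[OF il(1)] by (simp add: mult.commute)
    next
      case 3
      have "AE x in lebesgue_on \<Omega>. u i x * u l x = 0"
        using u il unfolding S_tuples_def by blast
      with 3 show ?thesis by simp
    qed
  qed
  moreover have "?u i \<in> K_cone \<Omega>" if "i \<in> {1..m}" for i
    using u w that unfolding S_tuples_def K_tuples_def by (cases "i = j") simp_all
  ultimately have "?u \<in> S_tuples m \<Omega>"
    unfolding S_tuples_def K_tuples_def mem_Collect_eq by (intro conjI ballI impI)
  then have "\<not> total_energy m \<Omega> f \<kappa> ?u < total_energy m \<Omega> f \<kappa> u"
    using no_less by blast
  then show ?thesis
    using total_energy_update[OF j, of \<Omega> f \<kappa> u w] by linarith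
qed

theorem theorem2p4:
  fixes \<Omega> :: "'a::euclidean_space set"
    and m :: nat
    and k :: real
    and lam :: "nat \<Rightarrow> real"
    and \<mu> f v :: "nat \<Rightarrow> 'a \<Rightarrow> real"
    and Q U :: "nat \<Rightarrow> 'a set"
  assumes dim: "DIM('a) \<ge> 2"
    and dom: "bounded_Lipschitz_domain \<Omega>"
    and k: "0 < k" "k < k_star \<Omega>"
    and lam: "\<And>i. i \<in> {1..m} \<Longrightarrow> lam i > 0"
    and \<mu>: "\<And>i. i \<in> {1..m} \<Longrightarrow> \<mu> i \<in> L_infinity"
    and supp_\<mu>: "\<And>i. i \<in> {1..m} \<Longrightarrow> ess_supp (\<mu> i) \<subseteq> \<Omega>"
    and f: "\<And>i. i \<in> {1..m} \<Longrightarrow> f i = (\<lambda>x. \<mu> i x - lam i)"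
    and v: "\<And>i. i \<in> {1..m} \<Longrightarrow> is_arg_min (energy \<Omega> (f i) k) (\<lambda>w. w \<in> K_cone \<Omega>) (v i)"
    and Q: "\<And>i. i \<in> {1..m} \<Longrightarrow> Q i = UNIV - {x. v i x \<le> 0}"
    and disj: "\<And>i j. i \<in> {1..m} \<Longrightarrow> j \<in> {1..m} \<Longrightarrow> i \<noteq> j \<Longrightarrow>
                 closure (Q i) \<inter> ess_supp (\<mu> j) = {}"
    and U: "\<And>i. i \<in> {1..m} \<Longrightarrow> open (U i) \<and> U i \<subseteq> ess_supp (\<mu> i)"
    and inf: "\<And>i. i \<in> {1..m} \<Longrightarrow> ess_inf_on (U i) (\<mu> i) > ereal (lam i)"
  shows "\<forall>u. is_arg_min (total_energy m \<Omega> f (\<lambda>_. k)) (\<lambda>w. w \<in> S_tuples m \<Omega>) u \<longrightarrow>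
           (\<forall>i\<in>{1..m}. closure (U i) \<subseteq> ess_supp (u i))"
proof (intro allI impI ballI subsetI)
  fix u i x
  assume min_u: "is_arg_min (total_energy m \<Omega> f (\<lambda>_. k)) (\<lambda>w. w \<in> S_tuples m \<Omega>) u"
    and i: "i \<in> {1..m}" and x: "x \<in> closure (U i)"
  interpret bounded_open \<Omega>
    using dom by unfold_locales (simp_all add: bounded_Lipschitz_domain_def)
  have u_S: "u \<in> S_tuples m \<Omega>"
    using min_u by (simp add: is_arg_min_def)
  then have u_K: "u j \<in> K_cone \<Omega>" if "j \<in> {1..m}" for j
    using that by (simp add: S_tuples_def K_tuples_def)
  have v_K: "v j \<in> K_cone \<Omega>" if "j \<in> {1..m}" for j
    using v[OF that] by (simp add: is_arg_min_def)
  have u_pair: "H01_pair (u j) (weak_grad \<Omega> (u j))" and v_pair: "H01_pair (v j) (weak_grad \<Omega> (v j))"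
    if "j \<in> {1..m}" for j
    using H01_imp_H01_pair u_K[OF that] v_K[OF that] by (simp_all add: K_cone_def)
  have u_nonneg: "AE x in M. 0 \<le> u j x" and v_nonneg: "AE x in M. 0 \<le> v j x" if "j \<in> {1..m}" for j
    using u_K[OF that] v_K[OF that] by (simp_all add: K_cone_def)
  have u_seg: "AE x in M. u j x * u l x = 0" if "j \<in> {1..m}" "l \<in> {1..m}" "j \<noteq> l" for j l
    using u_S that by (simp add: S_tuples_def)
  have f_L2: "f j \<in> L2 \<Omega>" if "j \<in> {1..m}" for j
    unfolding f[OF that] by (rule L_infinity_diff_const_L2[OF \<mu>[OF that]])
  have u_le_v: "AE x in M. u j x \<le> v j x" if j: "j \<in> {1..m}" for j
  proof (rule comparison[OF u_pair[OF j] v_pair[OF j] f_L2[OF j] order.strict_implies_order[OF k(1)] k(2)])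
    fix e t :: real
    assume et: "0 < e" "0 < t" "t \<le> 1"
    define p where "p x = smooth_pos e (u j x - v j x)" for x
    have "H01_pair (\<lambda>x. u j x - v j x) (\<lambda>x. weak_grad \<Omega> (u j) x - weak_grad \<Omega> (v j) x)"
      using H01_pair_linear[OF u_pair[OF j] v_pair[OF j], of "- 1"] by simp
    from H01_pair_smooth_pos[OF this et(1)]
    have p: "H01_pair p (\<lambda>x. smooth_pos' e (u j x - v j x) *\<^sub>R (weak_grad \<Omega> (u j) x - weak_grad \<Omega> (v j) x))"
      by (simp only: p_def[abs_def])
    have p_nonneg: "0 \<le> p x" for x
      unfolding p_def by (rule smooth_pos_nonneg[OF et(1)])
    have p_le: "p x \<le> max 0 (u j x - v j x)" for x
      unfolding p_def by (rule smooth_pos_le[OF et(1)])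
    \<comment> \<open>The bound \<open>t \<le> 1\<close> enters here: what is subtracted never
      exceeds the positive part of \<open>u j - v j\<close>, hence not \<open>u j\<close> itself
      where both functions are nonnegative.\<close>
    have tp: "t * p x \<le> max 0 (u j x - v j x)" for x
      using mult_right_mono[OF et(3) p_nonneg[of x]] p_le[of x] by simp
    let ?w = "\<lambda>x. u j x + (- t) * p x"
    have "?w \<in> H01 \<Omega>"
      by (rule H01_pair_imp_H01[OF H01_pair_linear[OF u_pair[OF j] p]])
    moreover have "AE x in M. 0 \<le> ?w x"
      using u_nonneg[OF j] v_nonneg[OF j]
    proof eventually_elim
      case (elim x)
      then show ?case using tp[of x] by (simp add: max_def split: if_splits)
    qed
    ultimately have w_K: "?w \<in> K_cone \<Omega>"
      by (simp add: K_cone_def)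
    have "energy \<Omega> (f j) k (u j) \<le> energy \<Omega> (f j) k ?w"
    proof (rule segregated_minimizer_energy_le[OF min_u j w_K])
      fix l assume l: "l \<in> {1..m}" "l \<noteq> j"
      show "AE x in M. ?w x * u l x = 0"
        using u_seg[OF j l(1) l(2)[symmetric]] v_nonneg[OF j]
      proof eventually_elim
        case (elim x)
        show ?case
        \<comment> \<open>Where \<open>u j\<close> vanishes, \<open>v j \<ge> 0\<close> leaves no
          positive part, so \<open>p\<close> vanishes too and the competitor keeps the zeros of
          \<open>u j\<close>.\<close>
        proof (cases "u j x = 0")
          case True
          then have "p x = 0"
            using p_le[of x] p_nonneg[of x] elim(2) by simp
          with True show ?thesis by simp
        next
          case False
          with elim(1) show ?thesis by simp
        qed
      qed
    qed
    then show "energy \<Omega> (f j) k (u j) \<le> energy \<Omega> (f j) k (\<lambda>x. u j x + t * - smooth_pos e (u j x - v j x))"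
      by (simp add: p_def)
    \<comment> \<open>Since \<open>v j\<close> minimises over the whole cone, the enlarged function
      only has to stay nonnegative, whatever the other components do.\<close>
    let ?z = "\<lambda>x. v j x + t * p x"
    have "?z \<in> H01 \<Omega>"
      by (rule H01_pair_imp_H01[OF H01_pair_linear[OF v_pair[OF j] p]])
    moreover have "AE x in M. 0 \<le> ?z x"
      using v_nonneg[OF j] by eventually_elim (simp add: p_nonneg et(2) less_imp_le)
    ultimately have "?z \<in> K_cone \<Omega>"
      by (simp add: K_cone_def)
    then have "\<not> energy \<Omega> (f j) k ?z < energy \<Omega> (f j) k (v j)"
      using v[OF j] unfolding is_arg_min_def by blast
    then show "energy \<Omega> (f j) k (v j) \<le> energy \<Omega> (f j) k (\<lambda>x. v j x + t * smooth_pos e (u j x - v j x))"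
      by (simp add: p_def)
  qed
  show "x \<in> ess_supp (u i)"
  proof (rule ccontr)
    assume "x \<notin> ess_supp (u i)"
    then obtain V where V: "open V" "x \<in> V" "AE y in lebesgue. y \<in> V \<longrightarrow> u i y = 0"
      unfolding ess_supp_def by blast
    have "open (U i)" "U i \<subseteq> ess_supp (\<mu> i)"
      using U[OF i] by simp_all
    have "V \<inter> U i \<noteq> {}"
      using x V(1,2) open_Int_closure_eq_empty[of V "U i"] by blast
    then obtain a where a: "a \<in> V \<inter> U i"
      by blast
    have "open (V \<inter> U i)"
      using V(1) \<open>open (U i)\<close> by (rule open_Int)
    then obtain r where r: "r > 0" "cball a r \<subseteq> V \<inter> U i"
      using a open_contains_cball by blast
    \<comment> \<open>The support condition on \<open>\<mu> i\<close> puts \<open>U i\<close> inside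
      \<open>\<Omega>\<close>, so the bump is a genuine test function there.\<close>
    have V\<Omega>: "V \<inter> U i \<subseteq> \<Omega>"
      using \<open>U i \<subseteq> ess_supp (\<mu> i)\<close> supp_\<mu>[OF i] by blast
    define \<phi> where "\<phi> = bump a r"
    have \<phi>: "\<phi> \<in> Cc_infinity (V \<inter> U i)"
      unfolding \<phi>_def by (rule Cc_infinity_bump[OF r])
    have \<phi>\<Omega>: "\<phi> \<in> Cc_infinity \<Omega>"
      by (rule Cc_infinity_mono[OF V\<Omega> \<phi>])
    have \<phi>_nonneg: "0 \<le> \<phi> y" for y
      unfolding \<phi>_def by (rule bump_nonneg)
    have \<phi>_0: "\<phi> y = 0" if "y \<notin> U i" for y
    proof -
      have "y \<notin> ball a r"
        using that r(2) ball_subset_cball[of a r] by blast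
      then have "\<not> 0 < \<phi> y"
        unfolding \<phi>_def bump_pos_iff[OF r(1)] .
      with \<phi>_nonneg[of y] show ?thesis by simp
    qed
    have zero: "AE y in M. y \<in> V \<inter> U i \<longrightarrow> u i y = 0"
      unfolding AE_M_iff using V(3) by eventually_elim simp
    have form: "0 \<le> energy_form (f i) k (u i) (weak_grad \<Omega> (u i)) \<phi> (grad \<phi>)"
    proof (rule energy_form_nonneg[OF u_pair[OF i] H01_pair_Cc_infinity[OF \<phi>\<Omega>] f_L2[OF i]])
      fix t :: real
      assume t: "0 < t" "t \<le> 1"
      let ?w = "\<lambda>y. u i y + t * \<phi> y"
      have "?w \<in> H01 \<Omega>"
        by (rule H01_pair_imp_H01[OF H01_pair_linear[OF u_pair[OF i] H01_pair_Cc_infinity[OF \<phi>\<Omega>]]])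
      moreover have "AE y in M. 0 \<le> ?w y"
        using u_nonneg[OF i] by eventually_elim (simp add: \<phi>_nonneg t(1) less_imp_le)
      ultimately have w_K: "?w \<in> K_cone \<Omega>"
        by (simp add: K_cone_def)
      show "energy \<Omega> (f i) k (u i) \<le> energy \<Omega> (f i) k ?w"
      proof (rule segregated_minimizer_energy_le[OF min_u i w_K])
        fix l assume l: "l \<in> {1..m}" "l \<noteq> i"
        show "AE y in M. ?w y * u l y = 0"
          using u_seg[OF i l(1) l(2)[symmetric]] u_le_v[OF l(1)] u_nonneg[OF l(1)]
        proof eventually_elim
          case (elim y)
          show ?case
          \<comment> \<open>On \<open>U i\<close> the point lies outside \<open>Q l\<close>, so 0
            \<le> \<open>u l\<close> \<le> \<open>v l\<close> \<le> 0; off \<open>U i\<close> the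
            bump vanishes and the old segregation applies.\<close>
          proof (cases "y \<in> U i")
            case True
            then have "y \<notin> closure (Q l)"
              using disj[OF l(1) i l(2)] \<open>U i \<subseteq> ess_supp (\<mu> i)\<close> by blast
            then have "y \<notin> Q l"
              using closure_subset by blast
            then have "v l y \<le> 0"
              by (simp add: Q[OF l(1)])
            with elim show ?thesis by simp
          next
            case False
            with \<phi>_0 elim(1) show ?thesis by simp
          qed
        qed
      qed
    qed
    have int: "integrable M (\<lambda>y. f i y * \<phi> y)"
      by (rule L2_integrable_mult[OF f_L2[OF i] Cc_infinity_L2[OF \<phi>\<Omega>]])
    \<comment> \<open>A strict lower bound on the essential infimum is a strict pointwise bound
      almost everywhere, which means \<open>f i > 0\<close> on \<open>U i\<close>.\<close>
    have "AE y in lebesgue_on (U i). ereal (lam i) < ereal (\<mu> i y)"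
      using inf[OF i] unfolding ess_inf_on_def by (rule less_LiminfD)
    then have "AE y in lebesgue. y \<in> U i \<longrightarrow> ereal (lam i) < ereal (\<mu> i y)"
      using \<open>open (U i)\<close> by (subst (asm) AE_restrict_space_iff) simp_all
    then have f_pos: "AE y in M. y \<in> U i \<longrightarrow> 0 < f i y"
      unfolding AE_M_iff by eventually_elim (simp add: f[OF i])
    have "AE y in M. 0 \<le> f i y * \<phi> y"
      using f_pos
    proof eventually_elim
      case (elim y)
      then show ?case
        using \<phi>_nonneg[of y] \<phi>_0[of y] by (cases "y \<in> U i") simp_all
    qed
    \<comment> \<open>Because \<open>u i\<close> vanishes near the bump, \<open>form\<close> reduces
      to the statement that this integral is at most 0; the sign of the integrand gives the reverse
      inequality.\<close>
    moreover have "(LINT y|M. f i y * \<phi> y) = 0"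
      using form integral_nonneg_AE[OF calculation]
      unfolding energy_form_vanishing[OF u_pair[OF i] \<open>open (V \<inter> U i)\<close> V\<Omega> zero \<phi>] by simp
    ultimately have "AE y in M. f i y * \<phi> y = 0"
      using integral_nonneg_eq_0_iff_AE[OF int] by simp
    then have "AE y in M. y \<notin> ball a r"
      using f_pos
    proof eventually_elim
      case (elim y)
      show ?case
      proof
        assume y: "y \<in> ball a r"
        then have "y \<in> U i"
          using r(2) ball_subset_cball[of a r] by blast
        moreover have "0 < \<phi> y"
          using y unfolding \<phi>_def bump_pos_iff[OF r(1)] .
        ultimately show False
          using elim by simp
      qed
    qed
    then have "AE y in lebesgue. y \<notin> ball a r"
      unfolding AE_M_iff
    proof eventually_elim
      case (elim y)
      then show ?case
        using r(2) ball_subset_cball[of a r] V\<Omega> by blast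
    qed
    then have "ball a r \<in> null_sets lebesgue"
      by (subst AE_iff_null_sets) simp_all
    then have "negligible (ball a r)"
      by (simp add: negligible_iff_null_sets)
    then show False
      using open_not_negligible[of "ball a r"] r(1) by simp
  qed
qed

end
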